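(* Consider the goodness-of-fit testing problem $H_0:\theta=\theta_0$ versus $H_1:\theta_0\in\mathcal{E}_a,\ \theta-\theta_0\in\Theta_a(r_{\varepsilon,\sigma})$, with $\alpha,\beta\in\,]0,1[$ fixed, $\alpha\le\beta$. Let $s,t>0$. In each of the following cases there exist $\varepsilon_0,\sigma_0\in\,]0,1[$ such that, for all $0<\varepsilon\le\varepsilon_0$ and $0<\sigma\le\sigma_0$, the minimax separation radius $\tilde r_{\varepsilon,\sigma}$ satisfies the stated bound. (i) If $b_j\sim j^{-t}$ and $a_j\sim j^{s}$, then $\tilde r^2_{\varepsilon,\sigma}\lesssim\varepsilon^{\frac{4s}{2s+2t+1/2}}\vee\left[\sigma\ln^{3/4}(1/\sigma)\right]^{2\left(\frac{s}{t}\wedge1\right)}$. (ii) If $b_j\sim j^{-t}$ and $a_j\sim\exp\{js\}$, then $\tilde r^2_{\varepsilon,\sigma}\lesssim\varepsilon^2\left[\ln(1/\varepsilon)\right]^{2t+\frac12}\vee\sigma^2\ln^{\frac32}(1/\sigma)$. (iii) If $b_j\sim\exp\{-jt\}$ and $a_j\sim j^s$, then $\tilde r^2_{\varepsilon,\sigma}\lesssim\left[\ln(1/\varepsilon)\right]^{-2s}\vee\left[\ln\left(\frac{1}{\sigma\ln^{1/2}(1/\sigma)}\right)\right]^{-2s}$. (iv) If $b_j\sim\exp\{-jt\}$ and $a_j\sim\exp\{js\}$, then $\tilde r^2_{\varepsilon,\sigma}\lesssim\varepsilon^{\frac{2s}{s+t}}\vee\left[\sigma\ln^{1/2}(1/\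sigma)\right]^{2\left(\frac{s}{t}\wedge1\right)}$.
   Context: Notation: $\mathbb{N}=\{1,2,\dots\}$, $x\wedge y=\min\{x,y\}$, $x\vee y=\max\{x,y\}$, $l^2(\mathbb{N})$ is the space of square-summable real sequences with norm $\|\theta\|^2=\sum_j\theta_j^2$. For sequences, $c_j\sim d_j$ means there are $0<\kappa_0\le\kappa_1<\infty$ with $\kappa_0\le c_j/d_j\le\kappa_1$ for all $j\in\mathbb{N}$. $c_{\varepsilon,\sigma}\lesssim d_{\varepsilon,\sigma}$ means $c_{\varepsilon,\sigma}\le\kappa_1d_{\varepsilon,\sigma}$ for a constant $0<\kappa_1<\infty$ not depending on $\varepsilon,\sigma$ in the considered range. Model. One observes $(Y,X)=(Y_j,X_j)_{j\in\mathbb{N}}$ with $Y_j=b_j\theta_j+\varepsilon\xi_j$, $X_j=b_j+\sigma\eta_j$, where $b=(b_j)$ is a positive (unknown) sequence, $\theta\in l^2(\mathbb{N})$ is unknown, $(\xi_j),(\eta_j)$ are mutually independent sequences of independent standard Gaussian variables, and $\varepsilon,\sigma>0$ are known. $\mathbb{P}_{\theta,b}$ denotes the law of $(Y,X)$. Classes. $a=(a_j)$ is a non-decreasing sequence of positive reals with $a_j\to+\infty$, $\mathcal{E}_a=\{\theta\in l^2(\mathbb{N}):\sum_j a_j^2\theta_j^2\le1\}$, $\Theta_a(r)=\{\theta\in\mathcal{E}_a:\|\theta\|\ge r\}$. Tests. The benchmark $\theta_0\in\mathcal{E}_a$, $\theta_0\neq0$, is known, so a test $\Psi=\Psi(Y,X)\in\{0,1\}$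 is a measurable function of the observations which may depend on $\theta_0$ ($\Psi=1$ means rejecting $H_0$). It is an $\alpha$-level test if $\mathbb{P}_{\theta_0,b}(\Psi=1)\le\alpha$ for every $\theta_0\in\mathcal{E}_a\setminus\{0\}$. Its maximal second kind error probability is $\beta_{\varepsilon,\sigma}(\Theta_a(r),\Psi)=\sup_{\theta_0\in\mathcal{E}_a\setminus\{0\},\,\theta-\theta_0\in\Theta_a(r)}\mathbb{P}_{\theta,b}(\Psi=0)$ (supremum over the empty set being $0$), its separation radius is $r_{\varepsilon,\sigma}(\mathcal{E}_a,\Psi,\beta)=\inf\{r>0:\beta_{\varepsilon,\sigma}(\Theta_a(r),\Psi)\le\beta\}$, and $\tilde r_{\varepsilon,\sigma}=\inf_\Psi r_{\varepsilon,\sigma}(\mathcal{E}_a,\Psi,\beta)$ over all $\alpha$-level tests. *)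

theory Defs
  imports "HOL-Probability.Probability"
begin

text \<open>
  Sequences indexed by \<open>{1, 2, \<dots>}\<close> are functions on \<^typ>\<open>nat\<close>. Elements of \<open>l\<^sup>2\<close> are
  normalised to vanish at the unused index \<open>0\<close>, so that sums over \<^typ>\<open>nat\<close> are sums over
  \<open>{1..}\<close>; the values \<open>a 0\<close> and \<open>b 0\<close> are irrelevant throughout.
\<close>

definition l2 :: "(nat \<Rightarrow> real) set" where
  "l2 = {\<theta>. \<theta> 0 = 0 \<and> summable (\<lambda>j. (\<theta> j)\<^sup>2)}"

definition l2_norm :: "(nat \<Rightarrow> real) \<Rightarrow> real" where
  "l2_norm \<theta> = sqrt (\<Sum>j. (\<theta> j)\<^sup>2)"

definition ellipsoid :: "(nat \<Rightarrow> real) \<Rightarrow> (nat \<Rightarrow> real) set" where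
  "ellipsoid a = {\<theta> \<in> l2. summable (\<lambda>j. (a j)\<^sup>2 * (\<theta> j)\<^sup>2) \<and> (\<Sum>j. (a j)\<^sup>2 * (\<theta> j)\<^sup>2) \<le> 1}"

definition benchmarks :: "(nat \<Rightarrow> real) \<Rightarrow> (nat \<Rightarrow> real) set" where
  "benchmarks a = ellipsoid a - {\<lambda>_. 0}"

definition separated_ellipsoid :: "(nat \<Rightarrow> real) \<Rightarrow> real \<Rightarrow> (nat \<Rightarrow> real) set" where
  "separated_ellipsoid a r = {\<theta> \<in> ellipsoid a. l2_norm \<theta> \<ge> r}"

definition seq_sim :: "(nat \<Rightarrow> real) \<Rightarrow> (nat \<Rightarrow> real) \<Rightarrow> bool" where
  "seq_sim c d \<longleftrightarrow> (\<exists>\<kappa>\<^sub>0 \<kappa>\<^sub>1. 0 < \<kappa>\<^sub>0 \<and> \<kappa>\<^sub>0 \<le> \<kappa>\<^sub>1 \<and> (\<forall>j\<ge>1. \<kappa>\<^sub>0 \<le> c j / d j \<and> c j / d j \<le> \<kappa>\<^sub>1))"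

type_synonym observation = "(nat \<Rightarrow> real) \<times> (nat \<Rightarrow> real)"

definition obs_space :: "observation measure" where
  "obs_space = (\<Pi>\<^sub>M j\<in>{1..}. borel) \<Otimes>\<^sub>M (\<Pi>\<^sub>M j\<in>{1..}. borel)"

definition white_noise :: "(nat \<Rightarrow> real) measure" where
  "white_noise = (\<Pi>\<^sub>M j\<in>{1..}. density lborel (\<lambda>x. ennreal (std_normal_density x)))"

definition obs_law :: "real \<Rightarrow> real \<Rightarrow> (nat \<Rightarrow> real) \<Rightarrow> (nat \<Rightarrow> real) \<Rightarrow> observation measure" where
  "obs_law \<epsilon> \<sigma> \<theta> b = distr (white_noise \<Otimes>\<^sub>M white_noise) obs_space
     (\<lambda>(\<xi>, \<eta>). (\<lambda>j\<in>{1..}. b j * \<theta> j + \<epsilon> * \<xi> j, \<lambda>j\<in>{1..}. b j + \<sigma> * \<eta> j))"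

text \<open>The first argument of a test is the known benchmark \<open>\<theta>\<^sub>0\<close>.\<close>

type_synonym test = "(nat \<Rightarrow> real) \<Rightarrow> observation \<Rightarrow> nat"

definition is_test :: "(nat \<Rightarrow> real) \<Rightarrow> test \<Rightarrow> bool" where
  "is_test a \<Psi> \<longleftrightarrow> (\<forall>\<theta>\<^sub>0\<in>benchmarks a. \<Psi> \<theta>\<^sub>0 \<in> obs_space \<rightarrow>\<^sub>M count_space {0, 1})"

text \<open>
  The sequence \<open>b\<close> is unknown to the statistician, so the level has to be guaranteed whatever
  positive \<open>b\<close> generated the data. (Controlling the level at a single \<open>b\<close> only would admit tests
  tailored to that \<open>b\<close>, for which observing \<open>X\<close> is pointless.)
\<close>

definition level_test :: "(nat \<Rightarrow> real) \<Rightarrow> real \<Rightarrow> real \<Rightarrow> real \<Rightarrow> test \<Rightarrow> bool" where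
  "level_test a \<alpha> \<epsilon> \<sigma> \<Psi> \<longleftrightarrow> is_test a \<Psi> \<and>
     (\<forall>b. (\<forall>j\<ge>1. b j > 0) \<longrightarrow>
       (\<forall>\<theta>\<^sub>0\<in>benchmarks a.
         measure (obs_law \<epsilon> \<sigma> \<theta>\<^sub>0 b) {\<omega> \<in> space obs_space. \<Psi> \<theta>\<^sub>0 \<omega> = 1} \<le> \<alpha>))"

text \<open>Inserting \<open>0\<close> only matters when there is no alternative: the supremum is then \<open>0\<close>.\<close>

definition second_kind_error ::
    "(nat \<Rightarrow> real) \<Rightarrow> (nat \<Rightarrow> real) \<Rightarrow> real \<Rightarrow> real \<Rightarrow> real \<Rightarrow> test \<Rightarrow> real" where
  "second_kind_error a b \<epsilon> \<sigma> r \<Psi> = Sup (insert 0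
     {measure (obs_law \<epsilon> \<sigma> \<theta> b) {\<omega> \<in> space obs_space. \<Psi> \<theta>\<^sub>0 \<omega> = 0} | \<theta>\<^sub>0 \<theta>.
        \<theta>\<^sub>0 \<in> benchmarks a \<and> (\<lambda>j. \<theta> j - \<theta>\<^sub>0 j) \<in> separated_ellipsoid a r})"

definition separation_radius ::
    "(nat \<Rightarrow> real) \<Rightarrow> (nat \<Rightarrow> real) \<Rightarrow> real \<Rightarrow> real \<Rightarrow> real \<Rightarrow> test \<Rightarrow> real" where
  "separation_radius a b \<beta> \<epsilon> \<sigma> \<Psi> = Inf {r. r > 0 \<and> second_kind_error a b \<epsilon> \<sigma> r \<Psi> \<le> \<beta>}"

definition minimax_radius ::
    "(nat \<Rightarrow> real) \<Rightarrow> (nat \<Rightarrow> real) \<Rightarrow> real \<Rightarrow> real \<Rightarrow> real \<Rightarrow> real \<Rightarrow> real" where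
  "minimax_radius a b \<alpha> \<beta> \<epsilon> \<sigma> =
     Inf {separation_radius a b \<beta> \<epsilon> \<sigma> \<Psi> | \<Psi>. level_test a \<alpha> \<epsilon> \<sigma> \<Psi>}"

definition lesssim_small :: "(real \<Rightarrow> real \<Rightarrow> real) \<Rightarrow> (real \<Rightarrow> real \<Rightarrow> real) \<Rightarrow> bool" where
  "lesssim_small c d \<longleftrightarrow>
     (\<exists>\<epsilon>\<^sub>0\<in>{0<..<1}. \<exists>\<sigma>\<^sub>0\<in>{0<..<1}. \<exists>\<kappa>\<^sub>1>0. \<forall>\<epsilon>\<in>{0<..\<epsilon>\<^sub>0}. \<forall>\<sigma>\<in>{0<..\<sigma>\<^sub>0}. c \<epsilon> \<sigma> \<le> \<kappa>\<^sub>1 * d \<epsilon> \<sigma>)"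

end

theory Submission
  imports Defs
begin

text \<open>
  The residual \<open>Y\<^sub>j - X\<^sub>j \<theta>\<^sub>0\<^sub>j\<close> equals \<open>b\<^sub>j (\<theta>\<^sub>j - \<theta>\<^sub>0\<^sub>j) + \<epsilon> \<xi>\<^sub>j - \<sigma> \<theta>\<^sub>0\<^sub>j \<eta>\<^sub>j\<close>. Its noise variance
  \<open>v\<^sub>j = \<epsilon>\<^sup>2 + \<sigma>\<^sup>2 \<theta>\<^sub>0\<^sub>j\<^sup>2\<close> is known, and its law under the hypothesis does not involve \<open>b\<close>. So the test that
  rejects for large values of \<open>\<Sum>\<^bsub>j \<le> D\<^esub> w\<^sub>j ((Y\<^sub>j - X\<^sub>j \<theta>\<^sub>0\<^sub>j)\<^sup>2 - v\<^sub>j)\<close> has its level guaranteed uniformly in \<open>b\<close>,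
  for any fixed weights. The minimax radius is taken at a given \<open>b\<close>, so the choice \<open>w\<^sub>j = b\<^sub>j\<^sup>-\<^sup>2\<close> is allowed,
  and it makes the statistic an unbiased estimate of \<open>\<Sum>\<^bsub>j \<le> D\<^esub> (\<theta>\<^sub>j - \<theta>\<^sub>0\<^sub>j)\<^sup>2\<close>. Chebyshev's inequality
  for both error probabilities bounds the squared radius by a constant times
  \<open>(\<Sum>\<^bsub>j \<le> D\<^esub> b\<^sub>j\<^sup>-\<^sup>4 v\<^sub>j\<^sup>2)\<^sup>1\<^sup>/\<^sup>2 + a\<^sub>D\<^sup>-\<^sup>2\<close>. By the ellipsoid constraint on \<open>\<theta>\<^sub>0\<close> the square root is at most
  \<open>\<epsilon>\<^sup>2 (\<Sum>\<^bsub>j \<le> D\<^esub> b\<^sub>j\<^sup>-\<^sup>4)\<^sup>1\<^sup>/\<^sup>2 + \<sigma>\<^sup>2 max\<^bsub>j \<le> D\<^esub> (a\<^sub>j b\<^sub>j)\<^sup>-\<^sup>2\<close>, and it remains to choose \<open>D\<close> in each of the four cases.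
\<close>

section \<open>Second moments of independent sums and Gaussian moments\<close>

text \<open>Rectangle events \<open>R i S T\<close> have product probability, and both factors split
  over a finite index set by the two independence hypotheses. The rectangles are stable under
  intersection, so independence extends to the sigma-algebras they generate, which contain all
  events of the pairs.\<close>

lemma indep_vars_pair_measure:
  assumes M: "prob_space M" and N: "prob_space N"
    and X: "prob_space.indep_vars M A X I" and Y: "prob_space.indep_vars N B Y I"
  shows "prob_space.indep_vars (M \<Otimes>\<^sub>M N) (\<lambda>i. A i \<Otimes>\<^sub>M B i) (\<lambda>i \<omega>. (X i (fst \<omega>), Y i (snd \<omega>))) I"
proof -
  interpret M: prob_space M by fact
  interpret N: prob_space N by fact
  interpret P: pair_prob_space M N ..
  have Xm [measurable]: "X i \<in> measurable M (A i)" if "i \<in> I" for i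
    using X that by (auto simp: M.indep_vars_def)
  have Ym [measurable]: "Y i \<in> measurable N (B i)" if "i \<in> I" for i
    using Y that by (auto simp: N.indep_vars_def)
  define R where "R i S T = (X i -` S \<inter> space M) \<times> (Y i -` T \<inter> space N)" for i S T
  define G where "G i = {R i S T | S T. S \<in> sets (A i) \<and> T \<in> sets (B i)}" for i
  have measure_Times: "P.prob (U \<times> V) = M.prob U * N.prob V" if "U \<in> sets M" "V \<in> sets N" for U V
    using that by (simp add: measure_def N.emeasure_pair_measure_Times enn2real_mult)
  have G_events: "G i \<subseteq> P.events" if "i \<in> I" for i
    using that by (auto simp: G_def R_def)
  have "P.indep_sets G I"
  proof (rule P.indep_setsI[OF G_events])
    fix C J assume J: "J \<noteq> {}" "J \<subseteq> I" "finite J" and C: "\<forall>j\<in>J. C j \<in> G j"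
    from C have "\<forall>j\<in>J. \<exists>S T. C j = R j S T \<and> S \<in> sets (A j) \<and> T \<in> sets (B j)"
      unfolding G_def by auto
    then obtain S T where ST: "\<And>j. j \<in> J \<Longrightarrow> C j = R j (S j) (T j)"
      "\<And>j. j \<in> J \<Longrightarrow> S j \<in> sets (A j)" "\<And>j. j \<in> J \<Longrightarrow> T j \<in> sets (B j)"
      by metis
    have SM: "X j -` S j \<inter> space M \<in> sets M" "Y j -` T j \<inter> space N \<in> sets N" if "j \<in> J" for j
      using measurable_sets[OF Xm ST(2)] measurable_sets[OF Ym ST(3)] that J by auto
    have "(\<Inter>j\<in>J. C j) = (\<Inter>j\<in>J. X j -` S j \<inter> space M) \<times> (\<Inter>j\<in>J. Y j -` T j \<inter> space N)"
      using J(1) ST(1) by (auto simp: R_def)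
    also have "P.prob \<dots> = M.prob (\<Inter>j\<in>J. X j -` S j \<inter> space M) * N.prob (\<Inter>j\<in>J. Y j -` T j \<inter> space N)"
      using J SM by (intro measure_Times sets.finite_INT) auto
    also have "\<dots> = (\<Prod>j\<in>J. P.prob (C j))"
      using M.indep_varsD[OF X, of J S] N.indep_varsD[OF Y, of J T] J ST
      by (simp add: R_def measure_Times SM prod.distrib)
    finally show "P.prob (\<Inter>j\<in>J. C j) = (\<Prod>j\<in>J. P.prob (C j))" .
  qed
  moreover have "Int_stable (G i)" for i
  proof (rule Int_stableI)
    fix C D assume "C \<in> G i" "D \<in> G i"
    then obtain S T S' T' where "C = R i S T" "D = R i S' T'"
      and "S \<in> sets (A i)" "T \<in> sets (B i)" "S' \<in> sets (A i)" "T' \<in> sets (B i)"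
      by (auto simp: G_def)
    moreover have "R i S T \<inter> R i S' T' = R i (S \<inter> S') (T \<inter> T')"
      by (auto simp: R_def)
    ultimately show "C \<inter> D \<in> G i"
      unfolding G_def by blast
  qed
  ultimately have indep: "P.indep_sets (\<lambda>i. sigma_sets (space (M \<Otimes>\<^sub>M N)) (G i)) I"
    by (rule P.indep_sets_sigma)
  \<comment> \<open>Both coordinates are measurable for the sigma-algebra generated by
    \<open>G i\<close>, since the preimage of a set under one coordinate is a rectangle whose other
    side is the whole space. Hence so is the pair.\<close>
  have sigma_sub: "(\<lambda>\<omega>. (X i (fst \<omega>), Y i (snd \<omega>))) -` C \<inter> space (M \<Otimes>\<^sub>M N) \<in> sigma_sets (space (M \<Otimes>\<^sub>M N)) (G i)"
    if i: "i \<in> I" and C: "C \<in> sets (A i \<Otimes>\<^sub>M B i)" for i C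
  proof -
    let ?\<Sigma> = "sigma (space (M \<Otimes>\<^sub>M N)) (G i)"
    have Gsub: "G i \<subseteq> Pow (space (M \<Otimes>\<^sub>M N))"
      using sets.sets_into_space G_events[OF i] by blast
    have "R i S (space (B i)) \<in> G i" if "S \<in> sets (A i)" for S
      using that unfolding G_def by blast
    moreover have "(\<lambda>\<omega>. X i (fst \<omega>)) -` S \<inter> space (M \<Otimes>\<^sub>M N) = R i S (space (B i))" for S
      using measurable_space[OF Ym[OF i]] by (auto simp: R_def space_pair_measure)
    ultimately have 1: "(\<lambda>\<omega>. X i (fst \<omega>)) \<in> measurable ?\<Sigma> (A i)"
      using measurable_space[OF Xm[OF i]] Gsub
      by (intro measurableI) (auto simp: space_measure_of_conv space_pair_measure)
    have "R i (space (A i)) T \<in> G i" if "T \<in> sets (B i)" for T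
      using that unfolding G_def by blast
    moreover have "(\<lambda>\<omega>. Y i (snd \<omega>)) -` T \<inter> space (M \<Otimes>\<^sub>M N) = R i (space (A i)) T" for T
      using measurable_space[OF Xm[OF i]] by (auto simp: R_def space_pair_measure)
    ultimately have 2: "(\<lambda>\<omega>. Y i (snd \<omega>)) \<in> measurable ?\<Sigma> (B i)"
      using measurable_space[OF Ym[OF i]] Gsub
      by (intro measurableI) (auto simp: space_measure_of_conv space_pair_measure)
    from measurable_sets[OF measurable_Pair[OF 1 2] C] Gsub show ?thesis
      by (simp add: space_measure_of_conv)
  qed
  show ?thesis
    unfolding P.indep_vars_def2
  proof (intro conjI ballI)
    show "(\<lambda>\<omega>. (X i (fst \<omega>), Y i (snd \<omega>))) \<in> measurable (M \<Otimes>\<^sub>M N) (A i \<Otimes>\<^sub>M B i)" if "i \<in> I" for i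
      using that by measurable
    show "P.indep_sets (\<lambda>i. {(\<lambda>\<omega>. (X i (fst \<omega>), Y i (snd \<omega>))) -` C \<inter> space (M \<Otimes>\<^sub>M N) |C. C \<in> sets (A i \<Otimes>\<^sub>M B i)}) I"
      using sigma_sub by (intro P.indep_sets_mono_sets[OF indep]) auto
  qed
qed

text \<open>Expanding the square leaves only the diagonal: for distinct indices independence factors
  the expectation of the product, and both factors are centred.\<close>

lemma (in prob_space) expectation_sum_square_indep:
  fixes X :: "'i \<Rightarrow> 'a \<Rightarrow> real"
  assumes I: "finite I" and indep: "indep_vars (\<lambda>_. borel) X I"
    and sq: "\<And>i. i \<in> I \<Longrightarrow> integrable M (\<lambda>\<omega>. (X i \<omega>)\<^sup>2)"
    and int: "\<And>i. i \<in> I \<Longrightarrow> integrable M (X i)"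
    and mean: "\<And>i. i \<in> I \<Longrightarrow> expectation (X i) = 0"
  shows "integrable M (\<lambda>\<omega>. (\<Sum>i\<in>I. X i \<omega>)\<^sup>2)"
    and "expectation (\<lambda>\<omega>. (\<Sum>i\<in>I. X i \<omega>)\<^sup>2) = (\<Sum>i\<in>I. expectation (\<lambda>\<omega>. (X i \<omega>)\<^sup>2))"
proof -
  have off: "integrable M (\<lambda>\<omega>. X i \<omega> * X j \<omega>)" "expectation (\<lambda>\<omega>. X i \<omega> * X j \<omega>) = 0"
    if "i \<in> I" "j \<in> I" "i \<noteq> j" for i j
  proof -
    have ij: "indep_vars (\<lambda>_. borel) X {i, j}"
      using indep by (rule indep_vars_subset) (use that in auto)
    show "integrable M (\<lambda>\<omega>. X i \<omega> * X j \<omega>)"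
      using indep_vars_integrable[OF _ ij] int that by auto
    show "expectation (\<lambda>\<omega>. X i \<omega> * X j \<omega>) = 0"
      using indep_vars_lebesgue_integral[OF _ ij] int mean that by auto
  qed
  have prod_int: "integrable M (\<lambda>\<omega>. X i \<omega> * X j \<omega>)" if "i \<in> I" "j \<in> I" for i j
    using off[of i j] sq[of i] that by (cases "i = j") (auto simp: power2_eq_square)
  have expand: "(\<lambda>\<omega>. (\<Sum>i\<in>I. X i \<omega>)\<^sup>2) = (\<lambda>\<omega>. \<Sum>i\<in>I. \<Sum>j\<in>I. X i \<omega> * X j \<omega>)"
    by (simp add: power2_eq_square sum_product)
  show "integrable M (\<lambda>\<omega>. (\<Sum>i\<in>I. X i \<omega>)\<^sup>2)"
    unfolding expand by (intro Bochner_Integration.integrable_sum prod_int)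
  have "expectation (\<lambda>\<omega>. (\<Sum>i\<in>I. X i \<omega>)\<^sup>2) = (\<Sum>i\<in>I. \<Sum>j\<in>I. expectation (\<lambda>\<omega>. X i \<omega> * X j \<omega>))"
    unfolding expand by (simp add: prod_int)
  also have "\<dots> = (\<Sum>i\<in>I. \<Sum>j\<in>I. if j = i then expectation (\<lambda>\<omega>. (X i \<omega>)\<^sup>2) else 0)"
    by (intro sum.cong refl) (auto simp: off power2_eq_square)
  also have "\<dots> = (\<Sum>i\<in>I. expectation (\<lambda>\<omega>. (X i \<omega>)\<^sup>2))"
    using I by (simp add: sum.delta)
  finally show "expectation (\<lambda>\<omega>. (\<Sum>i\<in>I. X i \<omega>)\<^sup>2) = (\<Sum>i\<in>I. expectation (\<lambda>\<omega>. (X i \<omega>)\<^sup>2))" .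
qed

section \<open>Moments of the Gaussian noise\<close>

abbreviation std_gaussian :: "real measure" where
  "std_gaussian \<equiv> density lborel (\<lambda>x. ennreal (std_normal_density x))"

text \<open>The even moments are the double factorials 1, 1, 3, 15, ... of the odd numbers, written
  through ordinary factorials.\<close>

definition gaussian_moment :: "nat \<Rightarrow> real" where
  "gaussian_moment p = (if even p then fact p / (2 ^ (p div 2) * fact (p div 2)) else 0)"

lemma gaussian_moment_simps:
  "gaussian_moment 0 = 1" "gaussian_moment 1 = 0" "gaussian_moment (Suc 0) = 0"
  "gaussian_moment 2 = 1" "gaussian_moment 3 = 0" "gaussian_moment 4 = 3"
  by (simp_all add: gaussian_moment_def fact_numeral)

lemma has_bochner_integral_std_gaussian_power:
  "has_bochner_integral std_gaussian (\<lambda>x. x ^ p) (gaussian_moment p)"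
proof -
  have "has_bochner_integral lborel (\<lambda>x. std_normal_density x * x ^ p) (gaussian_moment p)"
  proof (cases "even p")
    case True
    then obtain k where "p = 2 * k" by (elim evenE)
    then show ?thesis using std_normal_moment_even[of k] by (simp add: gaussian_moment_def)
  next
    case False
    then obtain k where "p = 2 * k + 1" by (elim oddE)
    then show ?thesis using std_normal_moment_odd[of k] by (simp add: gaussian_moment_def)
  qed
  then show ?thesis
    by (intro has_bochner_integral_density) (auto simp: normal_density_nonneg)
qed

lemma prob_space_std_gaussian: "prob_space std_gaussian"
  by (rule prob_space_normal_density) simp

lemma prob_space_white_noise: "prob_space white_noise"
  unfolding white_noise_def by (intro prob_space_PiM prob_space_std_gaussian)

lemma sets_white_noise [measurable_cong]: "sets white_noise = sets (\<Pi>\<^sub>M j\<in>{1..}. borel)"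
  unfolding white_noise_def by (intro sets_PiM_cong) auto

lemma distr_white_noise_component:
  assumes "j \<ge> 1"
  shows "distr white_noise borel (\<lambda>\<xi>. \<xi> j) = std_gaussian"
proof -
  have "distr white_noise borel (\<lambda>\<xi>. \<xi> j) = distr white_noise std_gaussian (\<lambda>\<xi>. \<xi> j)"
    by (intro distr_cong) auto
  also have "\<dots> = std_gaussian"
    using assms unfolding white_noise_def
    by (intro distr_PiM_component[where M = "\<lambda>_. std_gaussian"]) (auto simp: prob_space_std_gaussian)
  finally show ?thesis .
qed

text \<open>Independence is read off from the joint law. Points of \<open>white_noise\<close> are
  extensional on \<open>{1..}\<close>, so restricting to \<open>{1..}\<close> is the identity and
  the joint law is \<open>white_noise\<close>, a product of its marginals.\<close>

lemma indep_vars_white_noise: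
  "prob_space.indep_vars white_noise (\<lambda>_. borel) (\<lambda>j \<xi>. \<xi> j) {1..}"
proof -
  interpret prob_space white_noise by (rule prob_space_white_noise)
  have "distr white_noise (\<Pi>\<^sub>M j\<in>{1..}. borel) (\<lambda>\<xi>. \<lambda>j\<in>{1..}. \<xi> j) = distr white_noise white_noise (\<lambda>\<xi>. \<xi>)"
  proof (rule distr_cong)
    show "sets (\<Pi>\<^sub>M j\<in>{1..}. borel) = sets white_noise"
      by (rule sets_white_noise[symmetric])
  qed (auto simp: white_noise_def space_PiM PiE_def extensional_restrict)
  also have "\<dots> = (\<Pi>\<^sub>M j\<in>{1..}. distr white_noise borel (\<lambda>\<xi>. \<xi> j))"
    unfolding distr_id by (subst white_noise_def, intro PiM_cong) (auto simp: distr_white_noise_component)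
  finally show ?thesis
    by (subst indep_vars_iff_distr_eq_PiM') auto
qed

lemma has_bochner_integral_white_noise_power:
  assumes "j \<ge> 1"
  shows "has_bochner_integral white_noise (\<lambda>\<xi>. \<xi> j ^ p) (gaussian_moment p)"
proof -
  have "has_bochner_integral (distr white_noise borel (\<lambda>\<xi>. \<xi> j)) (\<lambda>x. x ^ p) (gaussian_moment p)"
    unfolding distr_white_noise_component[OF assms] by (rule has_bochner_integral_std_gaussian_power)
  then show ?thesis
    using assms by (simp add: has_bochner_integral_iff integrable_distr_eq integral_distr)
qed

abbreviation noise :: "observation measure" where
  "noise \<equiv> white_noise \<Otimes>\<^sub>M white_noise"

lemma prob_space_noise: "prob_space noise"
  by (intro prob_space_pair prob_space_white_noise)

lemma has_bochner_integral_noise_monomial: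
  assumes "j \<ge> 1"
  shows "has_bochner_integral noise (\<lambda>\<omega>. fst \<omega> j ^ p * snd \<omega> j ^ q) (gaussian_moment p * gaussian_moment q)"
proof -
  interpret W: prob_space white_noise by (rule prob_space_white_noise)
  interpret P: pair_prob_space white_noise white_noise ..
  note p = has_bochner_integral_white_noise_power[OF assms]
  have int: "integrable noise (\<lambda>\<omega>. fst \<omega> j ^ p * snd \<omega> j ^ q)"
    using p[of p] p[of q] by (intro P.Fubini_integrable)
      (auto simp: has_bochner_integral_iff abs_mult assms intro!: integrable_abs)
  moreover have "(\<integral>\<omega>. fst \<omega> j ^ p * snd \<omega> j ^ q \<partial>noise) = gaussian_moment p * gaussian_moment q"
    using p[of p] p[of q] P.integral_fst[of "\<lambda>x y. x j ^ p * y j ^ q"] int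
    by (simp add: has_bochner_integral_iff case_prod_beta')
  ultimately show ?thesis by (simp add: has_bochner_integral_iff)
qed

text \<open>These are the first four moments of a centred Gaussian of variance
  \<open>e\<^sup>2 + c\<^sup>2\<close>. Expanding the powers into monomials in the two coordinates
  gives them without identifying the law of \<open>W\<close>.\<close>

lemma has_bochner_integral_noise_combination:
  fixes e c :: real
  assumes "j \<ge> 1"
  defines "W \<equiv> \<lambda>\<omega>::observation. e * fst \<omega> j + c * snd \<omega> j"
  shows "has_bochner_integral noise W 0"
    and "has_bochner_integral noise (\<lambda>\<omega>. (W \<omega>)\<^sup>2) (e\<^sup>2 + c\<^sup>2)"
    and "has_bochner_integral noise (\<lambda>\<omega>. (W \<omega>) ^ 3) 0"
    and "has_bochner_integral noise (\<lambda>\<omega>. (W \<omega>) ^ 4) (3 * (e\<^sup>2 + c\<^sup>2)\<^sup>2)"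
proof -
  note intros = has_bochner_integral_add has_bochner_integral_mult_right
    has_bochner_integral_noise_monomial[OF assms(1)]
  note mono = has_bochner_integral_cong[OF refl]
  let ?m = "\<lambda>p q (\<omega>::observation). fst \<omega> j ^ p * snd \<omega> j ^ q"
  let ?g = "\<lambda>p q. gaussian_moment p * gaussian_moment q"
  have "has_bochner_integral noise (\<lambda>\<omega>. e * ?m 1 0 \<omega> + c * ?m 0 1 \<omega>) (e * ?g 1 0 + c * ?g 0 1)"
    by (intro intros)
  then show "has_bochner_integral noise W 0"
    by (simp add: W_def gaussian_moment_simps)
  have "has_bochner_integral noise (\<lambda>\<omega>. e\<^sup>2 * ?m 2 0 \<omega> + 2 * e * c * ?m 1 1 \<omega> + c\<^sup>2 * ?m 0 2 \<omega>)
      (e\<^sup>2 * ?g 2 0 + 2 * e * c * ?g 1 1 + c\<^sup>2 * ?g 0 2)"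
    by (intro intros)
  then show "has_bochner_integral noise (\<lambda>\<omega>. (W \<omega>)\<^sup>2) (e\<^sup>2 + c\<^sup>2)"
    by (rule mono[THEN iffD1, rotated -1])
      (auto simp: W_def gaussian_moment_simps power2_eq_square algebra_simps)
  have "has_bochner_integral noise
      (\<lambda>\<omega>. e ^ 3 * ?m 3 0 \<omega> + 3 * e\<^sup>2 * c * ?m 2 1 \<omega> + 3 * e * c\<^sup>2 * ?m 1 2 \<omega> + c ^ 3 * ?m 0 3 \<omega>)
      (e ^ 3 * ?g 3 0 + 3 * e\<^sup>2 * c * ?g 2 1 + 3 * e * c\<^sup>2 * ?g 1 2 + c ^ 3 * ?g 0 3)"
    by (intro intros)
  then show "has_bochner_integral noise (\<lambda>\<omega>. (W \<omega>) ^ 3) 0"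
    by (rule mono[THEN iffD1, rotated -1])
      (auto simp: W_def gaussian_moment_simps power2_eq_square power3_eq_cube algebra_simps)
  have "has_bochner_integral noise
      (\<lambda>\<omega>. e ^ 4 * ?m 4 0 \<omega> + 4 * e ^ 3 * c * ?m 3 1 \<omega> + 6 * e\<^sup>2 * c\<^sup>2 * ?m 2 2 \<omega>
        + 4 * e * c ^ 3 * ?m 1 3 \<omega> + c ^ 4 * ?m 0 4 \<omega>)
      (e ^ 4 * ?g 4 0 + 4 * e ^ 3 * c * ?g 3 1 + 6 * e\<^sup>2 * c\<^sup>2 * ?g 2 2
        + 4 * e * c ^ 3 * ?g 1 3 + c ^ 4 * ?g 0 4)"
    by (intro intros)
  then show "has_bochner_integral noise (\<lambda>\<omega>. (W \<omega>) ^ 4) (3 * (e\<^sup>2 + c\<^sup>2)\<^sup>2)"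
    by (rule mono[THEN iffD1, rotated -1])
      (auto simp: W_def gaussian_moment_simps power2_eq_square power3_eq_cube power4_eq_xxxx algebra_simps)
qed

text \<open>After centring, the summand is \<open>w j * (W\<^sup>2 - v + 2 * \<mu> * W)\<close>. Its
  quadratic part has variance \<open>3 * v\<^sup>2 - v\<^sup>2\<close>, its linear part has variance
  \<open>4 * \<mu>\<^sup>2 * v\<close>, and the two are uncorrelated because odd moments of
  \<open>W\<close> vanish. Chebyshev's inequality then applies to the independent sum.\<close>

lemma noise_quadratic_deviation:
  fixes \<mu> c w :: "nat \<Rightarrow> real" and e r :: real
  assumes "r > 0"
  defines "v \<equiv> \<lambda>j. e\<^sup>2 + (c j)\<^sup>2"
  shows "measure noise {\<omega> \<in> space noise.
      \<bar>(\<Sum>j=1..D. w j * ((\<mu> j + (e * fst \<omega> j + c j * snd \<omega> j))\<^sup>2 - v j)) - (\<Sum>j=1..D. w j * (\<mu> j)\<^sup>2)\<bar> \<ge> r}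
    \<le> (\<Sum>j=1..D. (w j)\<^sup>2 * (2 * (v j)\<^sup>2 + 4 * (\<mu> j)\<^sup>2 * v j)) / r\<^sup>2"
proof -
  interpret N: prob_space noise by (rule prob_space_noise)
  define W where "W j \<omega> = e * fst \<omega> j + c j * snd \<omega> j" for j and \<omega> :: observation
  define f where "f j x = w j * (x\<^sup>2 - v j + 2 * \<mu> j * x)" for j x
  define X where "X j \<omega> = f j (W j \<omega>)" for j \<omega>
  have W: "has_bochner_integral noise (W j) 0" "has_bochner_integral noise (\<lambda>\<omega>. (W j \<omega>)\<^sup>2) (v j)"
    "has_bochner_integral noise (\<lambda>\<omega>. (W j \<omega>) ^ 3) 0"
    "has_bochner_integral noise (\<lambda>\<omega>. (W j \<omega>) ^ 4) (3 * (v j)\<^sup>2)" if "j \<in> {1..D}" for j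
    using has_bochner_integral_noise_combination[of j e "c j"] that by (simp_all add: W_def[abs_def] v_def)
  have const: "has_bochner_integral noise (\<lambda>_. k) k" for k :: real
    by (simp add: has_bochner_integral_iff N.prob_space)
  have X1: "has_bochner_integral noise (X j) 0" if j: "j \<in> {1..D}" for j
  proof -
    have "has_bochner_integral noise (\<lambda>\<omega>. w j * ((W j \<omega>)\<^sup>2 - v j + 2 * \<mu> j * W j \<omega>))
        (w j * (v j - v j + 2 * \<mu> j * 0))"
      by (intro has_bochner_integral_mult_right has_bochner_integral_add has_bochner_integral_diff W[OF j] const)
    then show ?thesis by (simp add: X_def[abs_def] f_def)
  qed
  have X2: "has_bochner_integral noise (\<lambda>\<omega>. (X j \<omega>)\<^sup>2) ((w j)\<^sup>2 * (2 * (v j)\<^sup>2 + 4 * (\<mu> j)\<^sup>2 * v j))"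
    if j: "j \<in> {1..D}" for j
  proof -
    have "has_bochner_integral noise
        (\<lambda>\<omega>. (w j)\<^sup>2 * ((W j \<omega>) ^ 4 + 4 * \<mu> j * (W j \<omega>) ^ 3 + (4 * (\<mu> j)\<^sup>2 - 2 * v j) * (W j \<omega>)\<^sup>2
          + (- 4 * \<mu> j * v j) * W j \<omega> + (v j)\<^sup>2))
        ((w j)\<^sup>2 * (3 * (v j)\<^sup>2 + 4 * \<mu> j * 0 + (4 * (\<mu> j)\<^sup>2 - 2 * v j) * v j
          + (- 4 * \<mu> j * v j) * 0 + (v j)\<^sup>2))"
      by (intro has_bochner_integral_mult_right has_bochner_integral_add W[OF j] const)
    moreover have "(X j \<omega>)\<^sup>2 = (w j)\<^sup>2 * ((W j \<omega>) ^ 4 + 4 * \<mu> j * (W j \<omega>) ^ 3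
        + (4 * (\<mu> j)\<^sup>2 - 2 * v j) * (W j \<omega>)\<^sup>2 + (- 4 * \<mu> j * v j) * W j \<omega> + (v j)\<^sup>2)" for \<omega>
      unfolding X_def f_def by algebra
    moreover have "(w j)\<^sup>2 * (2 * (v j)\<^sup>2 + 4 * (\<mu> j)\<^sup>2 * v j) = (w j)\<^sup>2 * (3 * (v j)\<^sup>2 + 4 * \<mu> j * 0
        + (4 * (\<mu> j)\<^sup>2 - 2 * v j) * v j + (- 4 * \<mu> j * v j) * 0 + (v j)\<^sup>2)"
      by algebra
    ultimately show ?thesis by (simp only:)
  qed
  have indep: "N.indep_vars (\<lambda>_. borel) X {1..D}"
  proof -
    \<comment> \<open>Each \<open>X j\<close> is a fixed measurable function of the pair of noise
      coordinates at \<open>j\<close>, so it inherits independence from these pairs.\<close>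
    have "N.indep_vars (\<lambda>_. borel \<Otimes>\<^sub>M borel) (\<lambda>j \<omega>. (fst \<omega> j, snd \<omega> j)) {1..}"
      by (intro indep_vars_pair_measure prob_space_white_noise indep_vars_white_noise)
    moreover have "(\<lambda>p. f j (e * fst p + c j * snd p)) \<in> borel_measurable (borel \<Otimes>\<^sub>M borel)" for j
      unfolding f_def by measurable
    ultimately have "N.indep_vars (\<lambda>_. borel) (\<lambda>j \<omega>. f j (e * fst (fst \<omega> j, snd \<omega> j) + c j * snd (fst \<omega> j, snd \<omega> j))) {1..}"
      by (rule N.indep_vars_compose2[where Y = "\<lambda>j p. f j (e * fst p + c j * snd p)"])
    then have "N.indep_vars (\<lambda>_. borel) X {1..}"
      by (simp add: X_def[abs_def] W_def)
    then show ?thesis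
      by (rule N.indep_vars_subset) auto
  qed
  have X: "integrable noise (\<lambda>\<omega>. (X j \<omega>)\<^sup>2)" "integrable noise (X j)" "(\<integral>\<omega>. X j \<omega> \<partial>noise) = 0"
    "(\<integral>\<omega>. (X j \<omega>)\<^sup>2 \<partial>noise) = (w j)\<^sup>2 * (2 * (v j)\<^sup>2 + 4 * (\<mu> j)\<^sup>2 * v j)" if "j \<in> {1..D}" for j
    using X1[OF that] X2[OF that] unfolding has_bochner_integral_iff by blast+
  note sq = N.expectation_sum_square_indep[OF finite_atLeastAtMost indep X(1,2,3)]
  have S: "integrable noise (\<lambda>\<omega>. (\<Sum>j=1..D. X j \<omega>)\<^sup>2)"
    "(\<integral>\<omega>. (\<Sum>j=1..D. X j \<omega>)\<^sup>2 \<partial>noise) = (\<Sum>j=1..D. (w j)\<^sup>2 * (2 * (v j)\<^sup>2 + 4 * (\<mu> j)\<^sup>2 * v j))"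
    using sq X(4) by simp_all
  have mean: "(\<integral>\<omega>. (\<Sum>j=1..D. X j \<omega>) \<partial>noise) = 0"
    using X by (simp add: Bochner_Integration.integral_sum)
  have meas: "(\<lambda>\<omega>. \<Sum>j=1..D. X j \<omega>) \<in> borel_measurable noise"
    using X(2) by (intro borel_measurable_sum borel_measurable_integrable)
  have eq: "(\<Sum>j=1..D. w j * ((\<mu> j + (e * fst \<omega> j + c j * snd \<omega> j))\<^sup>2 - v j)) - (\<Sum>j=1..D. w j * (\<mu> j)\<^sup>2)
      = (\<Sum>j=1..D. X j \<omega>)" for \<omega>
    unfolding sum_subtractf[symmetric] X_def f_def W_def
    by (intro sum.cong refl) algebra
  have "measure noise {\<omega> \<in> space noise. \<bar>\<Sum>j=1..D. X j \<omega>\<bar> \<ge> r}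
      \<le> (\<Sum>j=1..D. (w j)\<^sup>2 * (2 * (v j)\<^sup>2 + 4 * (\<mu> j)\<^sup>2 * v j)) / r\<^sup>2"
    using N.Chebyshev_inequality[OF meas S(1) assms(1)] by (simp only: mean S(2) diff_zero)
  then show ?thesis by (simp only: eq)
qed

section \<open>The residual statistic\<close>

definition residual_statistic ::
    "real \<Rightarrow> real \<Rightarrow> (nat \<Rightarrow> real) \<Rightarrow> nat \<Rightarrow> (nat \<Rightarrow> real) \<Rightarrow> observation \<Rightarrow> real" where
  "residual_statistic \<epsilon> \<sigma> w D \<theta>\<^sub>0 \<omega> =
     (\<Sum>j=1..D. w j * ((fst \<omega> j - snd \<omega> j * \<theta>\<^sub>0 j)\<^sup>2 - (\<epsilon>\<^sup>2 + \<sigma>\<^sup>2 * (\<theta>\<^sub>0 j)\<^sup>2)))"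

lemma measurable_residual_statistic [measurable]:
  "residual_statistic \<epsilon> \<sigma> w D \<theta>\<^sub>0 \<in> borel_measurable obs_space"
  unfolding residual_statistic_def[abs_def] obs_space_def
  by (intro borel_measurable_sum) measurable

lemma measurable_observation:
  "(\<lambda>(\<xi>, \<eta>). (\<lambda>j\<in>{1..}. b j * \<theta> j + \<epsilon> * \<xi> j, \<lambda>j\<in>{1..}. b j + \<sigma> * \<eta> j)) \<in> measurable noise obs_space"
  unfolding obs_space_def by measurable

lemma prob_space_obs_law: "prob_space (obs_law \<epsilon> \<sigma> \<theta> b)"
  unfolding obs_law_def by (intro prob_space.prob_space_distr prob_space_noise measurable_observation)

lemma sets_obs_law: "sets (obs_law \<epsilon> \<sigma> \<theta> b) = sets obs_space"
  by (simp add: obs_law_def)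

lemma residual_statistic_deviation:
  fixes \<theta> \<theta>\<^sub>0 b w :: "nat \<Rightarrow> real" and \<epsilon> \<sigma> r :: real
  assumes "r > 0"
  defines "v \<equiv> \<lambda>j. \<epsilon>\<^sup>2 + \<sigma>\<^sup>2 * (\<theta>\<^sub>0 j)\<^sup>2" and "\<mu> \<equiv> \<lambda>j. b j * (\<theta> j - \<theta>\<^sub>0 j)"
  shows "measure (obs_law \<epsilon> \<sigma> \<theta> b) {\<omega> \<in> space obs_space.
      \<bar>residual_statistic \<epsilon> \<sigma> w D \<theta>\<^sub>0 \<omega> - (\<Sum>j=1..D. w j * (\<mu> j)\<^sup>2)\<bar> \<ge> r}
    \<le> (\<Sum>j=1..D. (w j)\<^sup>2 * (2 * (v j)\<^sup>2 + 4 * (\<mu> j)\<^sup>2 * v j)) / r\<^sup>2"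
proof -
  let ?A = "{\<omega> \<in> space obs_space.
      \<bar>residual_statistic \<epsilon> \<sigma> w D \<theta>\<^sub>0 \<omega> - (\<Sum>j=1..D. w j * (\<mu> j)\<^sup>2)\<bar> \<ge> r}"
  let ?h = "\<lambda>(\<xi>, \<eta>). (\<lambda>j\<in>{1..}. b j * \<theta> j + \<epsilon> * \<xi> j, \<lambda>j\<in>{1..}. b j + \<sigma> * \<eta> j)"
  have h: "?h \<in> measurable noise obs_space" by (rule measurable_observation)
  \<comment> \<open>The product \<open>b j * \<theta>\<^sub>0 j\<close> cancels the null part of the
    signal, and the noise enters with coefficients \<open>\<epsilon>\<close> and
    \<open>- \<sigma> * \<theta>\<^sub>0 j\<close>. The sum runs over indices from 1 on, where the
    restrictions in the observation map have no effect.\<close>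
  have stat: "residual_statistic \<epsilon> \<sigma> w D \<theta>\<^sub>0 (?h \<omega>)
      = (\<Sum>j=1..D. w j * ((\<mu> j + (\<epsilon> * fst \<omega> j + - \<sigma> * \<theta>\<^sub>0 j * snd \<omega> j))\<^sup>2 - (\<epsilon>\<^sup>2 + (- \<sigma> * \<theta>\<^sub>0 j)\<^sup>2)))" for \<omega>
    unfolding residual_statistic_def
    by (intro sum.cong refl) (auto simp: case_prod_beta \<mu>_def power_mult_distrib algebra_simps)
  have "?A \<in> sets obs_space" by measurable
  then have "measure (obs_law \<epsilon> \<sigma> \<theta> b) ?A = measure noise (?h -` ?A \<inter> space noise)"
    unfolding obs_law_def by (intro measure_distr h)
  also have "?h -` ?A \<inter> space noise = {\<omega> \<in> space noise.
      \<bar>residual_statistic \<epsilon> \<sigma> w D \<theta>\<^sub>0 (?h \<omega>) - (\<Sum>j=1..D. w j * (\<mu> j)\<^sup>2)\<bar> \<ge> r}"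
    using measurable_space[OF h] by auto
  also have "measure noise \<dots> \<le> (\<Sum>j=1..D. (w j)\<^sup>2 * (2 * (\<epsilon>\<^sup>2 + (- \<sigma> * \<theta>\<^sub>0 j)\<^sup>2)\<^sup>2
      + 4 * (\<mu> j)\<^sup>2 * (\<epsilon>\<^sup>2 + (- \<sigma> * \<theta>\<^sub>0 j)\<^sup>2))) / r\<^sup>2"
    unfolding stat by (rule noise_quadratic_deviation[OF assms(1)])
  finally show ?thesis by (simp add: v_def power_mult_distrib)
qed

section \<open>Ellipsoid geometry and well-behaved infima\<close>

lemma ellipsoid_partial_sum_le:
  assumes "\<theta> \<in> ellipsoid a" "finite I"
  shows "(\<Sum>j\<in>I. (a j)\<^sup>2 * (\<theta> j)\<^sup>2) \<le> 1"
  using assms sum_le_suminf[of "\<lambda>j. (a j)\<^sup>2 * (\<theta> j)\<^sup>2" I] by (auto simp: ellipsoid_def)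

text \<open>Beyond \<open>D\<close> monotonicity gives \<open>a j \<ge> a D\<close>, so each squared
  coordinate is at most its weighted version divided by \<open>(a D)\<^sup>2\<close>, and the
  weighted sum is at most 1.\<close>

lemma l2_norm_tail_le:
  assumes a: "\<And>j. j \<ge> 1 \<Longrightarrow> a j > 0" "mono_on {1..} a" and D: "D \<ge> 1" and \<theta>: "\<theta> \<in> ellipsoid a"
  shows "(l2_norm \<theta>)\<^sup>2 \<le> (\<Sum>j=1..D. (\<theta> j)\<^sup>2) + 1 / (a D)\<^sup>2"
proof -
  have sm: "summable (\<lambda>j. (\<theta> j)\<^sup>2)" "\<theta> 0 = 0" "summable (\<lambda>j. (a j)\<^sup>2 * (\<theta> j)\<^sup>2)"
    "(\<Sum>j. (a j)\<^sup>2 * (\<theta> j)\<^sup>2) \<le> 1"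
    using \<theta> by (auto simp: ellipsoid_def l2_def)
  let ?f = "\<lambda>j. if j \<in> {1..D} then (\<theta> j)\<^sup>2 else 0"
  have f: "?f sums (\<Sum>j=1..D. (\<theta> j)\<^sup>2)"
    by (rule sums_If_finite_set) simp
  have aD: "a D > 0" using a D by simp
  have le: "(\<theta> j)\<^sup>2 \<le> ?f j + (a j)\<^sup>2 * (\<theta> j)\<^sup>2 * (1 / (a D)\<^sup>2)" for j
  \<comment> \<open>Monotonicity of \<open>a\<close> starts at index 1. Index 0 is harmless because
    \<open>\<theta> 0 = 0\<close>.\<close>
  proof (cases "j = 0 \<or> j \<in> {1..D}")
    case True
    then show ?thesis using sm(2) by auto
  next
    case False
    then have "a D \<le> a j" using D a(2) by (auto simp: mono_on_def)
    then have "(a D)\<^sup>2 * (\<theta> j)\<^sup>2 \<le> (a j)\<^sup>2 * (\<theta> j)\<^sup>2"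
      using aD by (intro mult_right_mono power_mono) auto
    with aD False show ?thesis by (simp add: field_simps)
  qed
  have "(l2_norm \<theta>)\<^sup>2 = (\<Sum>j. (\<theta> j)\<^sup>2)"
    unfolding l2_norm_def using sm(1) by (simp add: suminf_nonneg)
  also have "\<dots> \<le> (\<Sum>j. ?f j + (a j)\<^sup>2 * (\<theta> j)\<^sup>2 * (1 / (a D)\<^sup>2))"
    using sm f by (intro suminf_le le summable_add summable_mult2) (auto simp: sums_iff)
  also have "\<dots> = (\<Sum>j=1..D. (\<theta> j)\<^sup>2) + (\<Sum>j. (a j)\<^sup>2 * (\<theta> j)\<^sup>2) * (1 / (a D)\<^sup>2)"
    using sm f by (subst suminf_add[symmetric]) (auto simp: sums_iff suminf_divide)
  also have "(\<Sum>j. (a j)\<^sup>2 * (\<theta> j)\<^sup>2) * (1 / (a D)\<^sup>2) \<le> 1 * (1 / (a D)\<^sup>2)"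
    using sm(4) by (intro mult_right_mono) auto
  finally show ?thesis by simp
qed

text \<open>The tail bound at cutoff 1. The factor 2 is not sharp; the point is that the ellipsoid
  is bounded, so no alternative survives at large radii.\<close>

lemma l2_norm_ellipsoid_le:
  assumes a: "\<And>j. j \<ge> 1 \<Longrightarrow> a j > 0" "mono_on {1..} a" and \<theta>: "\<theta> \<in> ellipsoid a"
  shows "l2_norm \<theta> \<le> sqrt (2 / (a 1)\<^sup>2)"
proof (rule real_le_rsqrt)
  have "(a 1)\<^sup>2 * (\<theta> 1)\<^sup>2 \<le> 1"
    using ellipsoid_partial_sum_le[OF \<theta>, of "{1}"] by simp
  then have "(\<theta> 1)\<^sup>2 \<le> 1 / (a 1)\<^sup>2"
    using a(1)[of 1] by (simp add: field_simps)
  with l2_norm_tail_le[OF a _ \<theta>, of 1] show "(l2_norm \<theta>)\<^sup>2 \<le> 2 / (a 1)\<^sup>2"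
    by simp
qed

text \<open>A lower bound passes to the infimum once the set of admissible radii is nonempty. Any
  radius exceeding all norms in the ellipsoid is admissible, since there the supremum of the error
  is 0.\<close>

lemma separation_radius_nonneg:
  assumes a: "\<And>j. j \<ge> 1 \<Longrightarrow> a j > 0" "mono_on {1..} a" and "\<beta> > 0"
  shows "0 \<le> separation_radius a b \<beta> \<epsilon> \<sigma> \<Psi>"
  unfolding separation_radius_def
proof (rule cInf_greatest)
  define r where "r = sqrt (2 / (a 1)\<^sup>2) + 1"
  have "separated_ellipsoid a r = {}"
    using l2_norm_ellipsoid_le[OF a] by (force simp: separated_ellipsoid_def r_def)
  then have "second_kind_error a b \<epsilon> \<sigma> r \<Psi> = 0"
    by (simp add: second_kind_error_def)
  moreover have "r > 0" by (auto simp: r_def intro: add_nonneg_pos)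
  ultimately show "{r. r > 0 \<and> second_kind_error a b \<epsilon> \<sigma> r \<Psi> \<le> \<beta>} \<noteq> {}"
    using \<open>\<beta> > 0\<close> by (auto intro!: exI[of _ r])
qed auto

text \<open>One test that achieves its error bound at \<open>r\<close> caps the infimum over all
  tests. Nonnegativity accompanies the upper bound so that it may later be squared.\<close>

lemma minimax_radius_bounds:
  assumes a: "\<And>j. j \<ge> 1 \<Longrightarrow> a j > 0" "mono_on {1..} a" and "\<beta> > 0"
    and level: "level_test a \<alpha> \<epsilon> \<sigma> \<Psi>"
    and r: "r > 0" "second_kind_error a b \<epsilon> \<sigma> r \<Psi> \<le> \<beta>"
  shows "0 \<le> minimax_radius a b \<alpha> \<beta> \<epsilon> \<sigma>" "minimax_radius a b \<alpha> \<beta> \<epsilon> \<sigma> \<le> r"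
proof -
  let ?R = "{separation_radius a b \<beta> \<epsilon> \<sigma> \<Psi> | \<Psi>. level_test a \<alpha> \<epsilon> \<sigma> \<Psi>}"
  have nonneg: "\<And>x. x \<in> ?R \<Longrightarrow> 0 \<le> x"
    using separation_radius_nonneg[OF a \<open>\<beta> > 0\<close>] by auto
  then show "0 \<le> minimax_radius a b \<alpha> \<beta> \<epsilon> \<sigma>"
    unfolding minimax_radius_def using level by (intro cInf_greatest) auto
  have "minimax_radius a b \<alpha> \<beta> \<epsilon> \<sigma> \<le> separation_radius a b \<beta> \<epsilon> \<sigma> \<Psi>"
    unfolding minimax_radius_def using nonneg level
    by (intro cInf_lower bdd_belowI[of _ 0]) auto
  also have "\<dots> \<le> r"
    unfolding separation_radius_def using r by (intro cInf_lower bdd_belowI[of _ 0]) auto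
  finally show "minimax_radius a b \<alpha> \<beta> \<epsilon> \<sigma> \<le> r" .
qed

section \<open>A nonasymptotic bound for the minimax radius\<close>

text \<open>The triangle inequality in l2 separates the two noise sources. For the
  \<open>\<sigma>\<close> part the l2 norm is replaced by the l1 norm, which the ellipsoid
  constraint on \<open>\<theta>\<^sub>0\<close> controls: \<open>B\<close> dominates every ratio
  \<open>1 / (a j * b j)\<^sup>2\<close> up to \<open>D\<close>.\<close>

lemma weighted_noise_level_le:
  fixes a b \<theta>\<^sub>0 :: "nat \<Rightarrow> real" and \<epsilon> \<sigma> B :: real
  assumes \<theta>\<^sub>0: "\<theta>\<^sub>0 \<in> ellipsoid a"
    and B: "B \<ge> 0" "\<And>j. j \<in> {1..D} \<Longrightarrow> 1 / (b j)\<^sup>2 \<le> B * (a j)\<^sup>2"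
  shows "sqrt (\<Sum>j=1..D. (1 / (b j)\<^sup>2 * (\<epsilon>\<^sup>2 + \<sigma>\<^sup>2 * (\<theta>\<^sub>0 j)\<^sup>2))\<^sup>2)
    \<le> \<epsilon>\<^sup>2 * sqrt (\<Sum>j=1..D. (1 / (b j)\<^sup>2)\<^sup>2) + \<sigma>\<^sup>2 * B"
proof -
  have "L2_set (\<lambda>j. 1 / (b j)\<^sup>2 * (\<epsilon>\<^sup>2 + \<sigma>\<^sup>2 * (\<theta>\<^sub>0 j)\<^sup>2)) {1..D}
      = L2_set (\<lambda>j. \<epsilon>\<^sup>2 * (1 / (b j)\<^sup>2) + \<sigma>\<^sup>2 * ((\<theta>\<^sub>0 j)\<^sup>2 / (b j)\<^sup>2)) {1..D}"
    by (intro L2_set_cong) (auto simp: add_divide_distrib)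
  also have "\<dots> \<le> L2_set (\<lambda>j. \<epsilon>\<^sup>2 * (1 / (b j)\<^sup>2)) {1..D} + L2_set (\<lambda>j. \<sigma>\<^sup>2 * ((\<theta>\<^sub>0 j)\<^sup>2 / (b j)\<^sup>2)) {1..D}"
    by (rule L2_set_triangle_ineq)
  also have "L2_set (\<lambda>j. \<epsilon>\<^sup>2 * (1 / (b j)\<^sup>2)) {1..D} = \<epsilon>\<^sup>2 * L2_set (\<lambda>j. 1 / (b j)\<^sup>2) {1..D}"
    by (rule L2_set_right_distrib[symmetric]) simp
  also have "L2_set (\<lambda>j. \<sigma>\<^sup>2 * ((\<theta>\<^sub>0 j)\<^sup>2 / (b j)\<^sup>2)) {1..D} \<le> (\<Sum>j=1..D. \<sigma>\<^sup>2 * ((\<theta>\<^sub>0 j)\<^sup>2 / (b j)\<^sup>2))"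
    by (rule L2_set_le_sum) simp
  also have "\<dots> \<le> (\<Sum>j=1..D. \<sigma>\<^sup>2 * (B * ((a j)\<^sup>2 * (\<theta>\<^sub>0 j)\<^sup>2)))"
  proof (intro sum_mono mult_left_mono)
    show "(\<theta>\<^sub>0 j)\<^sup>2 / (b j)\<^sup>2 \<le> B * ((a j)\<^sup>2 * (\<theta>\<^sub>0 j)\<^sup>2)" if "j \<in> {1..D}" for j
      using mult_right_mono[OF B(2)[OF that], of "(\<theta>\<^sub>0 j)\<^sup>2"] by (simp add: mult.assoc)
  qed simp
  also have "\<dots> = \<sigma>\<^sup>2 * (B * (\<Sum>j=1..D. (a j)\<^sup>2 * (\<theta>\<^sub>0 j)\<^sup>2))"
    by (simp add: sum_distrib_left)
  also have "\<dots> \<le> \<sigma>\<^sup>2 * (B * 1)"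
    using B(1) by (intro mult_left_mono ellipsoid_partial_sum_le[OF \<theta>\<^sub>0]) auto
  finally show ?thesis by (simp add: L2_set_def)
qed

text \<open>In \<open>\<kappa>\<close>, the entry \<open>2 / sqrt \<alpha>\<close> keeps the
  threshold below half of the signal, and \<open>20 / \<beta>\<close> makes the signal large enough
  for Chebyshev's inequality under the alternative. The last summand is the signal energy that may
  hide beyond \<open>D\<close>.\<close>

theorem minimax_radius_sq_le:
  fixes a b :: "nat \<Rightarrow> real" and \<alpha> \<beta> \<epsilon> \<sigma> B :: real
  assumes a: "\<And>j. j \<ge> 1 \<Longrightarrow> a j > 0" "mono_on {1..} a" and b: "\<And>j. j \<ge> 1 \<Longrightarrow> b j > 0"
    and \<alpha>: "0 < \<alpha>" and \<beta>: "0 < \<beta>" "\<beta> < 1" and \<epsilon>: "\<epsilon> > 0" and D: "D \<ge> 1"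
    and B: "B \<ge> 0" "\<And>j. j \<in> {1..D} \<Longrightarrow> 1 / (b j)\<^sup>2 \<le> B * (a j)\<^sup>2"
  defines "\<kappa> \<equiv> max (2 / sqrt \<alpha>) (20 / \<beta>)"
  shows "(minimax_radius a b \<alpha> \<beta> \<epsilon> \<sigma>)\<^sup>2
    \<le> 2 * \<kappa> * (\<epsilon>\<^sup>2 * sqrt (\<Sum>j=1..D. (1 / (b j)\<^sup>2)\<^sup>2) + \<sigma>\<^sup>2 * B) + 1 / (a D)\<^sup>2" (is "_ \<le> ?r2")
proof -
  define w where "w j = 1 / (b j)\<^sup>2" for j
  define v where "v \<theta>\<^sub>0 j = \<epsilon>\<^sup>2 + \<sigma>\<^sup>2 * (\<theta>\<^sub>0 j)\<^sup>2" for \<theta>\<^sub>0 :: "nat \<Rightarrow> real" and j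
  \<comment> \<open>\<open>S \<theta>\<^sub>0\<close> is the standard deviation of the statistic
    under the hypothesis, for every \<open>b\<close>. Chebyshev's inequality at
    \<open>\<tau>\<close> standard deviations gives
    \<open>1 / \<tau>\<^sup>2 = \<alpha>\<close>.\<close>
  define S where "S \<theta>\<^sub>0 = sqrt (2 * (\<Sum>j=1..D. (w j * v \<theta>\<^sub>0 j)\<^sup>2))" for \<theta>\<^sub>0
  define \<tau> where "\<tau> = 1 / sqrt \<alpha>"
  define T where "T = residual_statistic \<epsilon> \<sigma> w D"
  define \<Psi> :: test where "\<Psi> \<theta>\<^sub>0 \<omega> = (if T \<theta>\<^sub>0 \<omega> > \<tau> * S \<theta>\<^sub>0 then 1 else 0)" for \<theta>\<^sub>0 \<omega>
  define r where "r = sqrt ?r2"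
  have \<tau>: "\<tau> > 0" "\<tau>\<^sup>2 = 1 / \<alpha>" using \<alpha> by (auto simp: \<tau>_def power_divide)
  have \<kappa>: "2 * \<tau> \<le> \<kappa>" "20 / \<beta> \<le> \<kappa>" "\<kappa> > 0"
    using \<beta> by (auto simp: \<kappa>_def \<tau>_def less_max_iff_disj)
  have w: "w j > 0" if "j \<in> {1..D}" for j using b[of j] that by (simp add: w_def)
  have v: "v \<theta>\<^sub>0 j > 0" for \<theta>\<^sub>0 j using \<epsilon> by (auto simp: v_def intro: add_pos_nonneg)
  have S2: "(S \<theta>\<^sub>0)\<^sup>2 = 2 * (\<Sum>j=1..D. (w j * v \<theta>\<^sub>0 j)\<^sup>2)" for \<theta>\<^sub>0
    by (simp add: S_def sum_nonneg)
  have Spos: "S \<theta>\<^sub>0 > 0" for \<theta>\<^sub>0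
  proof -
    have "(\<Sum>j=1..D. (w j * v \<theta>\<^sub>0 j)\<^sup>2) > 0"
      using D w v by (intro sum_pos zero_less_power mult_pos_pos) auto
    then show ?thesis by (simp add: S_def)
  qed
  have wv_le: "w j * v \<theta>\<^sub>0 j \<le> S \<theta>\<^sub>0" if "j \<in> {1..D}" for j \<theta>\<^sub>0
  proof (rule power2_le_imp_le)
    have "(w j * v \<theta>\<^sub>0 j)\<^sup>2 \<le> (\<Sum>j=1..D. (w j * v \<theta>\<^sub>0 j)\<^sup>2)"
      using that by (intro member_le_sum) auto
    also have "\<dots> \<le> (S \<theta>\<^sub>0)\<^sup>2" unfolding S2 by (simp add: sum_nonneg)
    finally show "(w j * v \<theta>\<^sub>0 j)\<^sup>2 \<le> (S \<theta>\<^sub>0)\<^sup>2" .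
  qed (use Spos less_imp_le in blast)
  have r2: "?r2 > 0"
    using \<kappa>(3) B(1) a(1)[of D] D
    by (intro add_nonneg_pos mult_nonneg_nonneg add_nonneg_nonneg) (auto simp: sum_nonneg)
  have Tm: "T \<theta>\<^sub>0 \<in> borel_measurable obs_space" for \<theta>\<^sub>0
    unfolding T_def by measurable
  have dev: "measure (obs_law \<epsilon> \<sigma> \<theta> b') {\<omega> \<in> space obs_space. \<bar>T \<theta>\<^sub>0 \<omega> - (\<Sum>j=1..D. w j * (b' j * (\<theta> j - \<theta>\<^sub>0 j))\<^sup>2)\<bar> \<ge> x}
      \<le> (\<Sum>j=1..D. (w j)\<^sup>2 * (2 * (v \<theta>\<^sub>0 j)\<^sup>2 + 4 * (b' j * (\<theta> j - \<theta>\<^sub>0 j))\<^sup>2 * v \<theta>\<^sub>0 j)) / x\<^sup>2"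
    if "x > 0" for x \<theta> \<theta>\<^sub>0 b'
    unfolding T_def v_def by (rule residual_statistic_deviation[OF that])
  have level: "level_test a \<alpha> \<epsilon> \<sigma> \<Psi>"
    unfolding level_test_def is_test_def
  proof (intro conjI ballI allI impI)
    fix \<theta>\<^sub>0
    note [measurable] = Tm
    show "\<Psi> \<theta>\<^sub>0 \<in> obs_space \<rightarrow>\<^sub>M count_space {0, 1}"
      unfolding \<Psi>_def by measurable
    fix b' :: "nat \<Rightarrow> real"
    interpret P: prob_space "obs_law \<epsilon> \<sigma> \<theta>\<^sub>0 b'" by (rule prob_space_obs_law)
    \<comment> \<open>For \<open>\<theta> = \<theta>\<^sub>0\<close> the signal term is zero
      whatever \<open>b'\<close> is, so rejection is a deviation by at least the threshold.\<close>
    have "P.prob {\<omega> \<in> space obs_space. \<Psi> \<theta>\<^sub>0 \<omega> = 1}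
        \<le> P.prob {\<omega> \<in> space obs_space. \<bar>T \<theta>\<^sub>0 \<omega> - (\<Sum>j=1..D. w j * (b' j * (\<theta>\<^sub>0 j - \<theta>\<^sub>0 j))\<^sup>2)\<bar> \<ge> \<tau> * S \<theta>\<^sub>0}"
      unfolding \<Psi>_def by (intro P.finite_measure_mono) (auto simp: sets_obs_law)
    also have "\<dots> \<le> (\<Sum>j=1..D. (w j)\<^sup>2 * (2 * (v \<theta>\<^sub>0 j)\<^sup>2 + 4 * (b' j * (\<theta>\<^sub>0 j - \<theta>\<^sub>0 j))\<^sup>2 * v \<theta>\<^sub>0 j)) / (\<tau> * S \<theta>\<^sub>0)\<^sup>2"
      using \<tau>(1) Spos by (intro dev) simp
    also have "\<dots> = (S \<theta>\<^sub>0)\<^sup>2 / (\<tau> * S \<theta>\<^sub>0)\<^sup>2"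
      by (simp add: S2 sum_distrib_left power_mult_distrib mult.left_commute)
    also have "\<dots> = \<alpha>"
      using Spos[of \<theta>\<^sub>0] \<tau>(2) by (simp add: power_mult_distrib)
    finally show "P.prob {\<omega> \<in> space obs_space. \<Psi> \<theta>\<^sub>0 \<omega> = 1} \<le> \<alpha>" .
  qed
  have error: "measure (obs_law \<epsilon> \<sigma> \<theta> b) {\<omega> \<in> space obs_space. \<Psi> \<theta>\<^sub>0 \<omega> = 0} \<le> \<beta>"
    if \<theta>\<^sub>0: "\<theta>\<^sub>0 \<in> benchmarks a" and \<theta>: "(\<lambda>j. \<theta> j - \<theta>\<^sub>0 j) \<in> separated_ellipsoid a r" for \<theta> \<theta>\<^sub>0
  proof -
    note [measurable] = Tm
    interpret P: prob_space "obs_law \<epsilon> \<sigma> \<theta> b" by (rule prob_space_obs_law)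
    define \<delta> where "\<delta> = (\<lambda>j. \<theta> j - \<theta>\<^sub>0 j)"
    define m where "m = (\<Sum>j=1..D. (\<delta> j)\<^sup>2)"
    have \<delta>: "\<delta> \<in> ellipsoid a" "l2_norm \<delta> \<ge> r"
      using \<theta> by (auto simp: separated_ellipsoid_def \<delta>_def)
    have m_eq: "(\<Sum>j=1..D. w j * (b j * (\<theta> j - \<theta>\<^sub>0 j))\<^sup>2) = m"
      unfolding m_def w_def \<delta>_def
    proof (intro sum.cong refl)
      show "1 / (b j)\<^sup>2 * (b j * (\<theta> j - \<theta>\<^sub>0 j))\<^sup>2 = (\<theta> j - \<theta>\<^sub>0 j)\<^sup>2" if "j \<in> {1..D}" for j
        using b[of j] that by (simp add: power_mult_distrib)
    qed
    have "?r2 = r\<^sup>2" using r2 by (simp add: r_def)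
    also have "\<dots> \<le> (l2_norm \<delta>)\<^sup>2"
      using \<delta>(2) r2 by (intro power_mono) (auto simp: r_def intro: less_imp_le)
    also have "\<dots> \<le> m + 1 / (a D)\<^sup>2"
      unfolding m_def by (rule l2_norm_tail_le[OF a D \<delta>(1)])
    \<comment> \<open>The separation radius contains the tail bound as a summand, so subtracting it
      leaves a lower bound for the energy \<open>m\<close> in the first \<open>D\<close>
      coordinates.\<close>
    finally have m_ge: "2 * \<kappa> * (\<epsilon>\<^sup>2 * sqrt (\<Sum>j=1..D. (1 / (b j)\<^sup>2)\<^sup>2) + \<sigma>\<^sup>2 * B) \<le> m"
      by simp
    have "S \<theta>\<^sub>0 = sqrt 2 * sqrt (\<Sum>j=1..D. (1 / (b j)\<^sup>2 * (\<epsilon>\<^sup>2 + \<sigma>\<^sup>2 * (\<theta>\<^sub>0 j)\<^sup>2))\<^sup>2)"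
      by (simp add: S_def w_def v_def real_sqrt_mult)
    also have "\<dots> \<le> 2 * (\<epsilon>\<^sup>2 * sqrt (\<Sum>j=1..D. (1 / (b j)\<^sup>2)\<^sup>2) + \<sigma>\<^sup>2 * B)"
    proof (intro mult_mono weighted_noise_level_le[where a = a] B)
      show "sqrt 2 \<le> 2" by (rule real_le_lsqrt) auto
    qed (use \<theta>\<^sub>0 in \<open>auto simp: benchmarks_def sum_nonneg\<close>)
    finally have "\<kappa> * S \<theta>\<^sub>0 \<le> \<kappa> * (2 * (\<epsilon>\<^sup>2 * sqrt (\<Sum>j=1..D. (1 / (b j)\<^sup>2)\<^sup>2) + \<sigma>\<^sup>2 * B))"
      using \<kappa>(3) by (intro mult_left_mono) auto
    with m_ge have mS: "\<kappa> * S \<theta>\<^sub>0 \<le> m" by (simp add: algebra_simps)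
    have mpos: "m > 0" using mS mult_pos_pos[OF \<kappa>(3) Spos[of \<theta>\<^sub>0]] by linarith
    have "2 * \<tau> * S \<theta>\<^sub>0 \<le> \<kappa> * S \<theta>\<^sub>0"
      using \<kappa>(1) Spos[of \<theta>\<^sub>0] by (intro mult_right_mono) auto
    \<comment> \<open>The threshold is at most \<open>m / 2\<close>, whereas the statistic is
      centred at \<open>m\<close>, so acceptance forces a deviation of at least
      \<open>m / 2\<close>.\<close>
    with mS have half: "m / 2 \<le> m - \<tau> * S \<theta>\<^sub>0" by simp
    have far: "m / 2 \<le> \<bar>x - m\<bar>" if "\<not> \<tau> * S \<theta>\<^sub>0 < x" for x
      using half that by linarith
    have "20 / \<beta> * S \<theta>\<^sub>0 \<le> \<kappa> * S \<theta>\<^sub>0"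
      using \<kappa>(2) Spos[of \<theta>\<^sub>0] by (intro mult_right_mono) auto
    with mS have "20 / \<beta> * S \<theta>\<^sub>0 \<le> m" by (rule order_trans[rotated])
    then have S_le: "20 * S \<theta>\<^sub>0 \<le> \<beta> * m" using \<beta> by (simp add: field_simps)
    have "\<beta> * m \<le> 1 * m" using \<beta> mpos by (intro mult_right_mono) auto
    with S_le have S_le_m: "S \<theta>\<^sub>0 \<le> m" using Spos[of \<theta>\<^sub>0] by linarith
    have "P.prob {\<omega> \<in> space obs_space. \<Psi> \<theta>\<^sub>0 \<omega> = 0}
        \<le> P.prob {\<omega> \<in> space obs_space. \<bar>T \<theta>\<^sub>0 \<omega> - (\<Sum>j=1..D. w j * (b j * (\<theta> j - \<theta>\<^sub>0 j))\<^sup>2)\<bar> \<ge> m / 2}"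
      unfolding \<Psi>_def m_eq using far by (intro P.finite_measure_mono) (auto simp: sets_obs_law simp del: divide_le_eq_numeral1 split: if_splits)
    also have "\<dots> \<le> (\<Sum>j=1..D. (w j)\<^sup>2 * (2 * (v \<theta>\<^sub>0 j)\<^sup>2 + 4 * (b j * (\<theta> j - \<theta>\<^sub>0 j))\<^sup>2 * v \<theta>\<^sub>0 j)) / (m / 2)\<^sup>2"
      using mpos by (intro dev) simp
    also have "\<dots> \<le> (\<beta> * (m / 2)\<^sup>2) / (m / 2)\<^sup>2"
    proof (rule divide_right_mono)
      have "(\<Sum>j=1..D. (w j)\<^sup>2 * (2 * (v \<theta>\<^sub>0 j)\<^sup>2 + 4 * (b j * (\<theta> j - \<theta>\<^sub>0 j))\<^sup>2 * v \<theta>\<^sub>0 j))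
          = (\<Sum>j=1..D. 2 * (w j * v \<theta>\<^sub>0 j)\<^sup>2 + 4 * ((w j * v \<theta>\<^sub>0 j) * (w j * (b j * (\<theta> j - \<theta>\<^sub>0 j))\<^sup>2)))"
        by (intro sum.cong refl) algebra
      also have "\<dots> = (S \<theta>\<^sub>0)\<^sup>2 + 4 * (\<Sum>j=1..D. (w j * v \<theta>\<^sub>0 j) * (w j * (b j * (\<theta> j - \<theta>\<^sub>0 j))\<^sup>2))"
        by (simp only: S2 sum.distrib sum_distrib_left)
      \<comment> \<open>In the mixed term one factor is bounded by its maximum, which is at most
        \<open>S \<theta>\<^sub>0\<close>; what remains sums to \<open>m\<close>.\<close>
      also have "(\<Sum>j=1..D. (w j * v \<theta>\<^sub>0 j) * (w j * (b j * (\<theta> j - \<theta>\<^sub>0 j))\<^sup>2))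
          \<le> (\<Sum>j=1..D. S \<theta>\<^sub>0 * (w j * (b j * (\<theta> j - \<theta>\<^sub>0 j))\<^sup>2))"
        using w wv_le by (intro sum_mono mult_right_mono mult_nonneg_nonneg) (auto intro: less_imp_le)
      also have "\<dots> = S \<theta>\<^sub>0 * m" by (simp only: sum_distrib_left[symmetric] m_eq)
      \<comment> \<open>This is the origin of the constant 20: the total variance is at most
        \<open>5 * S \<theta>\<^sub>0 * m\<close>, and it has to stay below
        \<open>\<beta> * m\<^sup>2 / 4\<close>.\<close>
      also have "(S \<theta>\<^sub>0)\<^sup>2 + 4 * (S \<theta>\<^sub>0 * m) \<le> 5 * (S \<theta>\<^sub>0 * m)"
        using mult_left_mono[OF S_le_m, of "S \<theta>\<^sub>0"] Spos[of \<theta>\<^sub>0] by (simp add: power2_eq_square)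
      also have "\<dots> \<le> \<beta> * (m / 2)\<^sup>2"
        using mult_right_mono[OF S_le, of m] mpos by (simp add: power2_eq_square)
      finally show "(\<Sum>j=1..D. (w j)\<^sup>2 * (2 * (v \<theta>\<^sub>0 j)\<^sup>2 + 4 * (b j * (\<theta> j - \<theta>\<^sub>0 j))\<^sup>2 * v \<theta>\<^sub>0 j)) \<le> \<beta> * (m / 2)\<^sup>2"
        by simp
    qed simp
    also have "\<dots> = \<beta>" using mpos by simp
    finally show ?thesis .
  qed
  have "second_kind_error a b \<epsilon> \<sigma> r \<Psi> \<le> \<beta>"
    unfolding second_kind_error_def using error \<beta>(1) by (intro cSup_least) auto
  moreover have "r > 0" unfolding r_def using r2 by (rule real_sqrt_gt_zero)
  ultimately have "0 \<le> minimax_radius a b \<alpha> \<beta> \<epsilon> \<sigma>" "minimax_radius a b \<alpha> \<beta> \<epsilon> \<sigma> \<le> r"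
    using minimax_radius_bounds[OF a \<beta>(1) level] by blast+
  then have "(minimax_radius a b \<alpha> \<beta> \<epsilon> \<sigma>)\<^sup>2 \<le> r\<^sup>2"
    by (intro power_mono)
  then show ?thesis using r2 by (simp add: r_def)
qed

section \<open>Choice of the cutoff\<close>

lemma seq_sim_lower_bound:
  assumes "seq_sim c d" "\<And>j. j \<ge> 1 \<Longrightarrow> d j > 0"
  obtains \<kappa> where "\<kappa> > 0" "\<And>j. j \<ge> 1 \<Longrightarrow> \<kappa> * d j \<le> c j"
  using assms unfolding seq_sim_def by (auto simp: pos_le_divide_eq)

text \<open>Reduces each regime to choosing \<open>D\<close> and \<open>B\<close> for the model
  sequences \<open>g\<close> and \<open>h\<close>. The comparison constants rescale \<open>B\<close>
  and the three terms by factors independent of the noise levels, which are collected in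
  \<open>K\<close>.\<close>

lemma lesssim_minimax_radius:
  fixes a b g h :: "nat \<Rightarrow> real" and \<alpha> \<beta> \<epsilon>\<^sub>0 \<sigma>\<^sub>0 C :: real
  assumes a: "\<And>j. j \<ge> 1 \<Longrightarrow> a j > 0" "mono_on {1..} a" and b: "\<And>j. j \<ge> 1 \<Longrightarrow> b j > 0"
    and \<alpha>: "0 < \<alpha>" and \<beta>: "0 < \<beta>" "\<beta> < 1"
    and sim: "seq_sim b g" "seq_sim a h"
    and pos: "\<And>j. j \<ge> 1 \<Longrightarrow> g j > 0" "\<And>j. j \<ge> 1 \<Longrightarrow> h j > 0"
    and small: "0 < \<epsilon>\<^sub>0" "\<epsilon>\<^sub>0 < 1" "0 < \<sigma>\<^sub>0" "\<sigma>\<^sub>0 < 1" and C: "C > 0"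
    and bound: "\<And>\<epsilon> \<sigma>. 0 < \<epsilon> \<Longrightarrow> \<epsilon> \<le> \<epsilon>\<^sub>0 \<Longrightarrow> 0 < \<sigma> \<Longrightarrow> \<sigma> \<le> \<sigma>\<^sub>0 \<Longrightarrow>
      \<exists>D\<ge>1. \<exists>B\<ge>0. (\<forall>j\<in>{1..D}. 1 / (g j)\<^sup>2 \<le> B * (h j)\<^sup>2)
        \<and> \<epsilon>\<^sup>2 * sqrt (\<Sum>j=1..D. (1 / (g j)\<^sup>2)\<^sup>2) \<le> C * Q \<epsilon> \<sigma>
        \<and> \<sigma>\<^sup>2 * B \<le> C * Q \<epsilon> \<sigma> \<and> 1 / (h D)\<^sup>2 \<le> C * Q \<epsilon> \<sigma>"
  shows "lesssim_small (\<lambda>\<epsilon> \<sigma>. (minimax_radius a b \<alpha> \<beta> \<epsilon> \<sigma>)\<^sup>2) Q"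
proof -
  obtain p where p: "p > 0" "\<And>j. j \<ge> 1 \<Longrightarrow> p * g j \<le> b j"
    using seq_sim_lower_bound[OF sim(1) pos(1)] by blast
  obtain q where q: "q > 0" "\<And>j. j \<ge> 1 \<Longrightarrow> q * h j \<le> a j"
    using seq_sim_lower_bound[OF sim(2) pos(2)] by blast
  have inv_b: "1 / (b j)\<^sup>2 \<le> 1 / p\<^sup>2 * (1 / (g j)\<^sup>2)" if "j \<ge> 1" for j
  proof -
    have "(p * g j)\<^sup>2 \<le> (b j)\<^sup>2" using p(1) pos(1)[OF that] by (intro power_mono p(2) that) auto
    then have "1 / (b j)\<^sup>2 \<le> 1 / (p * g j)\<^sup>2"
      using p(1) pos(1)[OF that] by (intro divide_left_mono) (auto intro!: mult_pos_pos simp: b[OF that])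
    then show ?thesis by (simp add: power_mult_distrib)
  qed
  have a_sq: "q\<^sup>2 * (h j)\<^sup>2 \<le> (a j)\<^sup>2" if "j \<ge> 1" for j
    using power_mono[OF q(2)[OF that], of 2] q(1) pos(2)[OF that] by (simp add: power_mult_distrib)
  have inv_a: "1 / (a j)\<^sup>2 \<le> 1 / q\<^sup>2 * (1 / (h j)\<^sup>2)" if "j \<ge> 1" for j
  proof -
    have "1 / (a j)\<^sup>2 \<le> 1 / (q\<^sup>2 * (h j)\<^sup>2)"
      using q(1) pos(2)[OF that] a(1)[OF that] by (intro divide_left_mono a_sq that mult_pos_pos) auto
    then show ?thesis by simp
  qed
  define \<kappa> where "\<kappa> = max (2 / sqrt \<alpha>) (20 / \<beta>)"
  have \<kappa>: "\<kappa> > 0" using \<beta> by (auto simp: \<kappa>_def less_max_iff_disj)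
  define K where "K = 2 * \<kappa> * (1 / p\<^sup>2 + 1 / (p\<^sup>2 * q\<^sup>2)) + 1 / q\<^sup>2"
  have K: "K > 0" using \<kappa> p(1) q(1) by (auto simp: K_def intro!: add_nonneg_pos mult_nonneg_nonneg)
  have "(minimax_radius a b \<alpha> \<beta> \<epsilon> \<sigma>)\<^sup>2 \<le> (K * C) * Q \<epsilon> \<sigma>"
    if \<epsilon>: "\<epsilon> \<in> {0<..\<epsilon>\<^sub>0}" and \<sigma>: "\<sigma> \<in> {0<..\<sigma>\<^sub>0}" for \<epsilon> \<sigma>
  proof -
    from bound[of \<epsilon> \<sigma>] \<epsilon> \<sigma> obtain D B where D: "D \<ge> 1" and B: "B \<ge> 0"
      and gh: "\<forall>j\<in>{1..D}. 1 / (g j)\<^sup>2 \<le> B * (h j)\<^sup>2"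
      and R: "\<epsilon>\<^sup>2 * sqrt (\<Sum>j=1..D. (1 / (g j)\<^sup>2)\<^sup>2) \<le> C * Q \<epsilon> \<sigma>"
      and S: "\<sigma>\<^sup>2 * B \<le> C * Q \<epsilon> \<sigma>" and H: "1 / (h D)\<^sup>2 \<le> C * Q \<epsilon> \<sigma>"
      by auto
    define B' where "B' = B / (p\<^sup>2 * q\<^sup>2)"
    have B': "1 / (b j)\<^sup>2 \<le> B' * (a j)\<^sup>2" if j: "j \<in> {1..D}" for j
    proof -
      have "1 / (b j)\<^sup>2 \<le> 1 / p\<^sup>2 * (1 / (g j)\<^sup>2)" using j by (intro inv_b) auto
      also have "\<dots> \<le> 1 / p\<^sup>2 * (B * (h j)\<^sup>2)" using gh j by (intro mult_left_mono) auto
      also have "\<dots> = B' * (q\<^sup>2 * (h j)\<^sup>2)" using q(1) by (simp add: B'_def)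
      also have "\<dots> \<le> B' * (a j)\<^sup>2" using j B by (intro mult_left_mono a_sq) (auto simp: B'_def)
      finally show ?thesis .
    qed
    have sum_le: "sqrt (\<Sum>j=1..D. (1 / (b j)\<^sup>2)\<^sup>2) \<le> 1 / p\<^sup>2 * sqrt (\<Sum>j=1..D. (1 / (g j)\<^sup>2)\<^sup>2)"
    proof -
      have "L2_set (\<lambda>j. 1 / (b j)\<^sup>2) {1..D} \<le> L2_set (\<lambda>j. 1 / p\<^sup>2 * (1 / (g j)\<^sup>2)) {1..D}"
        by (intro L2_set_mono inv_b) auto
      also have "\<dots> = 1 / p\<^sup>2 * L2_set (\<lambda>j. 1 / (g j)\<^sup>2) {1..D}"
        by (intro L2_set_right_distrib[symmetric]) auto
      finally show ?thesis by (simp add: L2_set_def)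
    qed
    have "(minimax_radius a b \<alpha> \<beta> \<epsilon> \<sigma>)\<^sup>2
        \<le> 2 * \<kappa> * (\<epsilon>\<^sup>2 * sqrt (\<Sum>j=1..D. (1 / (b j)\<^sup>2)\<^sup>2) + \<sigma>\<^sup>2 * B') + 1 / (a D)\<^sup>2"
      unfolding \<kappa>_def using \<epsilon> B by (intro minimax_radius_sq_le a b \<alpha> \<beta> D B') (auto simp: B'_def)
    also have "\<dots> \<le> 2 * \<kappa> * (\<epsilon>\<^sup>2 * (1 / p\<^sup>2 * sqrt (\<Sum>j=1..D. (1 / (g j)\<^sup>2)\<^sup>2)) + \<sigma>\<^sup>2 * B') + 1 / q\<^sup>2 * (1 / (h D)\<^sup>2)"
      using \<kappa> by (intro add_mono mult_left_mono sum_le inv_a D order_refl) auto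
    also have "\<dots> = 2 * \<kappa> * (1 / p\<^sup>2 * (\<epsilon>\<^sup>2 * sqrt (\<Sum>j=1..D. (1 / (g j)\<^sup>2)\<^sup>2)) + 1 / (p\<^sup>2 * q\<^sup>2) * (\<sigma>\<^sup>2 * B))
        + 1 / q\<^sup>2 * (1 / (h D)\<^sup>2)"
      by (simp add: B'_def)
    also have "\<dots> \<le> 2 * \<kappa> * (1 / p\<^sup>2 * (C * Q \<epsilon> \<sigma>) + 1 / (p\<^sup>2 * q\<^sup>2) * (C * Q \<epsilon> \<sigma>)) + 1 / q\<^sup>2 * (C * Q \<epsilon> \<sigma>)"
      using \<kappa> by (intro add_mono mult_left_mono R S H) auto
    also have "\<dots> = (K * C) * Q \<epsilon> \<sigma>"
      unfolding K_def by (simp only: distrib_left distrib_right mult.assoc)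
    finally show ?thesis .
  qed
  then show ?thesis
    unfolding lesssim_small_def using small mult_pos_pos[OF K C]
    by (intro bexI[of _ \<epsilon>\<^sub>0] bexI[of _ \<sigma>\<^sub>0] exI[of _ "K * C"]) auto
qed

section \<open>Growth estimates and the cutoff on a logarithmic scale\<close>

lemma powr_le_exp:
  fixes x p q :: real
  assumes "x > 0" "p > 0" "q > 0"
  shows "x powr p \<le> (p / q) powr p * exp (q * x)"
proof -
  \<comment> \<open>Rescaling by the maximiser \<open>p / q\<close> of
    \<open>x powr p * exp (- q * x)\<close> lets \<open>ln z \<le> z - 1\<close> be applied at
    \<open>z = q * x / p\<close>. The gain from \<open>- 1\<close> is dropped.\<close>
  have "ln x = ln (q * x / p) + ln (p / q)"
    using assms by (simp add: ln_div ln_mult)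
  also have "\<dots> \<le> q * x / p + ln (p / q)"
    using ln_le_minus_one[of "q * x / p"] assms by simp
  finally have "p * ln x \<le> p * (q * x / p + ln (p / q))"
    using assms by (intro mult_left_mono) auto
  also have "\<dots> = p * ln (p / q) + q * x"
    using assms by (simp add: distrib_left)
  finally have "exp (p * ln x) \<le> exp (p * ln (p / q)) * exp (q * x)"
    by (simp add: exp_add[symmetric])
  then show ?thesis using assms by (simp add: powr_def)
qed

text \<open>There are at most \<open>x\<close> terms, each at most \<open>x powr (4 * t)\<close>;
  the square root of their total supplies the extra \<open>1 / 2\<close> in the exponent.\<close>

lemma sqrt_sum_powr_le:
  fixes t x :: real
  assumes "t > 0" "D \<ge> 1" "real D \<le> x"
  shows "sqrt (\<Sum>j=1..D. (1 / (real j powr (- t))\<^sup>2)\<^sup>2) \<le> x powr (2 * t + 1 / 2)"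
proof (rule real_le_lsqrt)
  have "(\<Sum>j=1..D. (1 / (real j powr (- t))\<^sup>2)\<^sup>2) \<le> (\<Sum>j=1..D. x powr (4 * t))"
  proof (rule sum_mono)
    fix j assume j: "j \<in> {1..D}"
    have "(1 / (real j powr (- t))\<^sup>2)\<^sup>2 = real j powr (4 * t)"
      using j by (simp add: powr_minus power_divide powr_power power_inverse inverse_eq_divide)
    also have "\<dots> \<le> x powr (4 * t)" using j assms by (intro powr_mono2) auto
    finally show "(1 / (real j powr (- t))\<^sup>2)\<^sup>2 \<le> x powr (4 * t)" .
  qed
  also have "\<dots> = real D * x powr (4 * t)" by simp
  also have "\<dots> \<le> x powr 1 * x powr (4 * t)" using assms by (intro mult_right_mono) auto
  also have "\<dots> = (x powr (2 * t + 1 / 2))\<^sup>2"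
    unfolding powr_add[symmetric] using assms by (simp add: powr_power algebra_simps)
  finally show "(\<Sum>j=1..D. (1 / (real j powr (- t))\<^sup>2)\<^sup>2) \<le> (x powr (2 * t + 1 / 2))\<^sup>2" .
qed auto

text \<open>Bounding the l2 norm by the l1 norm is cheap here: the sum is geometric and comparable
  to its last term.\<close>

lemma sqrt_sum_exp_le:
  fixes t x :: real
  assumes "t > 0" "real D \<le> x"
  shows "sqrt (\<Sum>j=1..D. (1 / (exp (- real j * t))\<^sup>2)\<^sup>2) \<le> 1 / (1 - exp (- 2 * t)) * exp (2 * t * x)"
proof -
  let ?c = "1 / (1 - exp (- 2 * t))"
  \<comment> \<open>The second identity is the fixed-point equation that closes the induction for
    the geometric sum.\<close>
  have c: "?c > 0" "?c * exp (- 2 * t) + 1 = ?c" using assms(1) by (auto simp: field_simps)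
  have eq: "1 / (exp (- real j * t))\<^sup>2 = exp (2 * t * real j)" for j
    by (simp add: exp_minus power_inverse exp_of_nat_mult[symmetric] exp_double[symmetric] field_simps)
  have geo: "(\<Sum>j=1..n. exp (2 * t * real j)) \<le> ?c * exp (2 * t * real n)" for n
  proof (induction n)
    case 0
    then show ?case using c(1) by simp
  next
    case (Suc n)
    have "(\<Sum>j=1..Suc n. exp (2 * t * real j)) \<le> ?c * exp (2 * t * real n) + exp (2 * t * real (Suc n))"
      using Suc by simp
    also have "exp (2 * t * real n) = exp (- 2 * t) * exp (2 * t * real (Suc n))"
      by (simp add: exp_add[symmetric] algebra_simps)
    also have "?c * (exp (- 2 * t) * exp (2 * t * real (Suc n))) + exp (2 * t * real (Suc n))
        = (?c * exp (- 2 * t) + 1) * exp (2 * t * real (Suc n))"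
      by (simp only: distrib_right mult.assoc mult_1_left)
    finally show ?case by (simp only: c(2))
  qed
  have "sqrt (\<Sum>j=1..D. (1 / (exp (- real j * t))\<^sup>2)\<^sup>2) = L2_set (\<lambda>j. exp (2 * t * real j)) {1..D}"
    by (simp only: eq L2_set_def)
  also have "\<dots> \<le> (\<Sum>j=1..D. exp (2 * t * real j))" by (rule L2_set_le_sum) simp
  also have "\<dots> \<le> ?c * exp (2 * t * real D)" by (rule geo)
  also have "\<dots> \<le> ?c * exp (2 * t * x)" using c(1) assms by (intro mult_left_mono) auto
  finally show ?thesis .
qed

text \<open>Here \<open>y\<close> is the cutoff on the scale where the squared bias is
  \<open>exp (- 2 * s * y)\<close> and the \<open>\<epsilon>\<close> term grows like
  \<open>exp (d * y)\<close>. The first candidate in the minimum equates bias and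
  \<open>\<epsilon>\<close> term. The second equates bias and \<open>\<sigma>\<close> term when
  \<open>s < t\<close>, and otherwise makes the bias at most \<open>\<sigma>\<^sup>2\<close>. The
  factor \<open>L\<close> stands for a power of the logarithm; being at least 1, it can only enlarge
  the bound.\<close>

lemma balanced_cutoff:
  fixes s t d \<epsilon> \<sigma> L :: real
  assumes st: "s > 0" "t > 0" "d > 0" and \<epsilon>: "0 < \<epsilon>" "\<epsilon> < 1" and \<sigma>: "0 < \<sigma>" "\<sigma> < 1" and L: "L \<ge> 1"
  defines "y \<equiv> min (2 * ln (1 / \<epsilon>) / (2 * s + d)) (ln (1 / \<sigma>) / t)"
  shows "\<epsilon>\<^sup>2 * exp (d * y) \<le> \<epsilon> powr (4 * s / (2 * s + d))"
    and "\<sigma>\<^sup>2 * exp (max (2 * t - 2 * s) 0 * y) \<le> (\<sigma> * L) powr (2 * min (s / t) 1)"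
    and "exp (- 2 * s * y) \<le> max (\<epsilon> powr (4 * s / (2 * s + d))) ((\<sigma> * L) powr (2 * min (s / t) 1))"
proof -
  define u where "u = ln (1 / \<epsilon>)"
  define w where "w = ln (1 / \<sigma>)"
  have u: "u > 0" "ln \<epsilon> = - u" "\<epsilon> = exp (- u)" using \<epsilon> by (auto simp: u_def ln_div)
  have w: "w > 0" "ln \<sigma> = - w" "\<sigma> = exp (- w)" using \<sigma> by (auto simp: w_def ln_div)
  have y: "y \<le> 2 * u / (2 * s + d)" "y \<le> w / t" "y = 2 * u / (2 * s + d) \<or> y = w / t"
    by (auto simp: y_def u_def w_def min_def)
  have \<epsilon>p: "\<epsilon> powr p = exp (- (p * u))" for p using \<epsilon> by (simp add: powr_def u(2))
  have \<sigma>p: "\<sigma> powr p = exp (- (p * w))" for p using \<sigma> by (simp add: powr_def w(2))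
  have sq: "\<epsilon>\<^sup>2 = exp (- 2 * u)" "\<sigma>\<^sup>2 = exp (- 2 * w)"
    by (simp_all add: u(3) w(3) exp_double[symmetric])
  have L_le: "\<sigma> powr p \<le> (\<sigma> * L) powr p" if "p \<ge> 0" for p
    using that \<sigma> L by (intro powr_mono2) auto
  have min_nonneg: "2 * min (s / t) 1 \<ge> 0" using st by simp
  have "d * y \<le> d * (2 * u / (2 * s + d))" using y(1) st by (intro mult_left_mono) auto
  also have "\<dots> = 2 * u - 4 * s / (2 * s + d) * u" using st by (simp add: field_simps)
  finally show "\<epsilon>\<^sup>2 * exp (d * y) \<le> \<epsilon> powr (4 * s / (2 * s + d))"
    unfolding sq \<epsilon>p by (simp add: exp_add[symmetric])
  have "max (2 * t - 2 * s) 0 * y \<le> max (2 * t - 2 * s) 0 * (w / t)"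
    using y(2) by (intro mult_left_mono) auto
  \<comment> \<open>If \<open>t > s\<close>, the left side is
    \<open>2 * w - 2 * (s / t) * w\<close>; otherwise both sides are zero.\<close>
  also have "\<dots> = 2 * w - 2 * min (s / t) 1 * w"
    using st by (auto simp: max_def min_def field_simps)
  finally have "\<sigma>\<^sup>2 * exp (max (2 * t - 2 * s) 0 * y) \<le> \<sigma> powr (2 * min (s / t) 1)"
    unfolding sq \<sigma>p by (simp add: exp_add[symmetric])
  also note L_le[OF min_nonneg]
  finally show "\<sigma>\<^sup>2 * exp (max (2 * t - 2 * s) 0 * y) \<le> (\<sigma> * L) powr (2 * min (s / t) 1)" .
  have "exp (- 2 * s * (w / t)) \<le> \<sigma> powr (2 * min (s / t) 1)"
    unfolding \<sigma>p using w(1) mult_right_mono[of "min (s / t) 1" "s / t" w] by (simp add: mult.assoc)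
  also note L_le[OF min_nonneg]
  finally have "exp (- 2 * s * (w / t)) \<le> (\<sigma> * L) powr (2 * min (s / t) 1)" .
  moreover have "exp (- 2 * s * (2 * u / (2 * s + d))) = \<epsilon> powr (4 * s / (2 * s + d))"
    unfolding \<epsilon>p by simp
  ultimately show "exp (- 2 * s * y) \<le> max (\<epsilon> powr (4 * s / (2 * s + d))) ((\<sigma> * L) powr (2 * min (s / t) 1))"
    using y(3) by (auto simp: le_max_iff_disj)
qed

lemma ln_inverse_ge:
  fixes x k :: real
  assumes "0 < x" "x \<le> exp (- k)"
  shows "k \<le> ln (1 / x)"
proof -
  have "ln x \<le> - k" using assms by (metis ln_exp ln_le_cancel_iff exp_gt_zero)
  then show ?thesis using assms by (simp add: ln_div)
qed

text \<open>Two ways to undo the rounding: losing 1 costs a constant factor when \<open>a\<close> is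
  exponential, and losing a factor 2 does so when \<open>a\<close> is polynomial.\<close>

lemma obtain_floor:
  fixes x :: real
  assumes "x \<ge> 1"
  obtains D :: nat where "D \<ge> 1" "real D \<le> x" "x \<le> real D + 1" "x / 2 \<le> real D"
proof -
  have "1 \<le> \<lfloor>x\<rfloor>" using assms by (simp add: le_floor_iff)
  then have "1 \<le> nat \<lfloor>x\<rfloor>" "real (nat \<lfloor>x\<rfloor>) = of_int \<lfloor>x\<rfloor>" by linarith+
  then show ?thesis using that[of "nat \<lfloor>x\<rfloor>"] by linarith
qed

section \<open>The four decay regimes\<close>

theorem theorem3p2:
  fixes a b :: "nat \<Rightarrow> real" and s t \<alpha> \<beta> :: real
  assumes "0 < \<alpha>" "\<alpha> < 1" "0 < \<beta>" "\<beta> < 1" "\<alpha> \<le> \<beta>"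
    and "s > 0" "t > 0"
    and "\<And>j. j \<ge> 1 \<Longrightarrow> b j > 0"
    and "\<And>j. j \<ge> 1 \<Longrightarrow> a j > 0"
    and "mono_on {1..} a"
    and "filterlim a at_top sequentially"
  shows
    "(seq_sim b (\<lambda>j. real j powr (- t)) \<and> seq_sim a (\<lambda>j. real j powr s) \<longrightarrow>
        lesssim_small (\<lambda>\<epsilon> \<sigma>. (minimax_radius a b \<alpha> \<beta> \<epsilon> \<sigma>)\<^sup>2)
          (\<lambda>\<epsilon> \<sigma>. max (\<epsilon> powr (4 * s / (2 * s + 2 * t + 1 / 2)))
                     ((\<sigma> * ln (1 / \<sigma>) powr (3 / 4)) powr (2 * min (s / t) 1))))
   \<and> (seq_sim b (\<lambda>j. real j powr (- t)) \<and> seq_sim a (\<lambda>j. exp (real j * s)) \<longrightarrow>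
        lesssim_small (\<lambda>\<epsilon> \<sigma>. (minimax_radius a b \<alpha> \<beta> \<epsilon> \<sigma>)\<^sup>2)
          (\<lambda>\<epsilon> \<sigma>. max (\<epsilon>\<^sup>2 * ln (1 / \<epsilon>) powr (2 * t + 1 / 2))
                     (\<sigma>\<^sup>2 * ln (1 / \<sigma>) powr (3 / 2))))
   \<and> (seq_sim b (\<lambda>j. exp (- real j * t)) \<and> seq_sim a (\<lambda>j. real j powr s) \<longrightarrow>
        lesssim_small (\<lambda>\<epsilon> \<sigma>. (minimax_radius a b \<alpha> \<beta> \<epsilon> \<sigma>)\<^sup>2)
          (\<lambda>\<epsilon> \<sigma>. max (ln (1 / \<epsilon>) powr (- 2 * s))
                     (ln (1 / (\<sigma> * ln (1 / \<sigma>) powr (1 / 2))) powr (- 2 * s))))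
   \<and> (seq_sim b (\<lambda>j. exp (- real j * t)) \<and> seq_sim a (\<lambda>j. exp (real j * s)) \<longrightarrow>
        lesssim_small (\<lambda>\<epsilon> \<sigma>. (minimax_radius a b \<alpha> \<beta> \<epsilon> \<sigma>)\<^sup>2)
          (\<lambda>\<epsilon> \<sigma>. max (\<epsilon> powr (2 * s / (s + t)))
                     ((\<sigma> * ln (1 / \<sigma>) powr (1 / 2)) powr (2 * min (s / t) 1))))"
proof -
  note a = assms(9,10) and b = assms(8) and levels = assms(1,3,4) and s = assms(6) and t = assms(7)
  let ?c = "1 / (1 - exp (- 2 * t))"
  have c: "?c > 0" using t by simp
  have small: "0 < exp (- k)" "exp (- k) < 1" if "k > 0" for k :: real using that by auto
  \<comment> \<open>Admissible noise levels are written as \<open>exp (- k)\<close> and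
    \<open>exp (- l)\<close>, so that they become the lower bounds \<open>k\<close> and
    \<open>l\<close> for the logarithms.\<close>
  have rate: "lesssim_small (\<lambda>\<epsilon> \<sigma>. (minimax_radius a b \<alpha> \<beta> \<epsilon> \<sigma>)\<^sup>2) Q"
    if "seq_sim b g" "seq_sim a h" "k > 0" "l > 0" "C > 0"
      "\<And>j. j \<ge> 1 \<Longrightarrow> g j > 0" "\<And>j. j \<ge> 1 \<Longrightarrow> h j > 0"
      "\<And>\<epsilon> \<sigma>. 0 < \<epsilon> \<Longrightarrow> \<epsilon> \<le> exp (- k) \<Longrightarrow> 0 < \<sigma> \<Longrightarrow> \<sigma> \<le> exp (- l) \<Longrightarrow>
        \<exists>D\<ge>1. \<exists>B\<ge>0. (\<forall>j\<in>{1..D}. 1 / (g j)\<^sup>2 \<le> B * (h j)\<^sup>2)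
          \<and> \<epsilon>\<^sup>2 * sqrt (\<Sum>j=1..D. (1 / (g j)\<^sup>2)\<^sup>2) \<le> C * Q \<epsilon> \<sigma>
          \<and> \<sigma>\<^sup>2 * B \<le> C * Q \<epsilon> \<sigma> \<and> 1 / (h D)\<^sup>2 \<le> C * Q \<epsilon> \<sigma>"
    for g h :: "nat \<Rightarrow> real" and k l C :: real and Q
    by (rule lesssim_minimax_radius[where g = g and h = h and \<epsilon>\<^sub>0 = "exp (- k)" and \<sigma>\<^sub>0 = "exp (- l)" and C = C])
      (fact a b levels that small[OF that(3)] small[OF that(4)])+
  have powr_ge_1: "1 \<le> x powr p" if "x \<ge> 1" "p \<ge> 0" for x p :: real
    using that powr_mono[of 0 p x] by simp
  have le_trans_mult: "x \<le> C * q" if "x \<le> k * z" "k \<le> C" "0 \<le> k" "0 \<le> z" "z \<le> q" for x k z C q :: real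
  proof -
    have "k * z \<le> C * q" using that by (intro mult_mono) auto
    with that(1) show ?thesis by linarith
  qed
  have div_powr: "(x / k) powr (- p) = k powr p * x powr (- p)" if "x > 0" "k > 0" for x k p :: real
    using that by (simp add: powr_divide powr_minus_divide)
  have div_powr: "(x / k) powr (- p) = k powr p * x powr (- p)" if "x > 0" "k > 0" for x k p :: real
    using that by (simp add: powr_divide powr_minus_divide)
  have div_powr: "(x / k) powr (- p) = k powr p * x powr (- p)" if "x > 0" "k > 0" for x k p :: real
    using that by (simp add: powr_divide powr_minus_divide)
  have div_powr: "(x / k) powr (- p) = k powr p * x powr (- p)" if "x > 0" "k > 0" for x k p :: real
    using that by (simp add: powr_divide powr_minus_divide)
  have poly_sq: "1 / (real j powr (- t))\<^sup>2 = real j powr (2 * t)" "(real j powr s)\<^sup>2 = real j powr (2 * s)"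
    "1 / (real j powr s)\<^sup>2 = real j powr (- 2 * s)" if "j \<ge> 1" for j :: nat
    using that by (simp_all add: powr_minus powr_power power_divide inverse_eq_divide mult.commute)
  have exp_sq: "1 / (exp (- real j * t))\<^sup>2 = exp (2 * t * real j)" "(exp (real j * s))\<^sup>2 = exp (2 * s * real j)"
    "1 / (exp (real j * s))\<^sup>2 = exp (- 2 * s * real j)" for j :: nat
    by (simp_all add: exp_double[symmetric] exp_minus field_simps)

  let ?Qi = "\<lambda>\<epsilon> \<sigma>. max (\<epsilon> powr (4 * s / (2 * s + 2 * t + 1 / 2)))
      ((\<sigma> * ln (1 / \<sigma>) powr (3 / 4)) powr (2 * min (s / t) 1))"
  have i: "lesssim_small (\<lambda>\<epsilon> \<sigma>. (minimax_radius a b \<alpha> \<beta> \<epsilon> \<sigma>)\<^sup>2) ?Qi"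
    if sim: "seq_sim b (\<lambda>j. real j powr (- t))" "seq_sim a (\<lambda>j. real j powr s)"
  proof (rule rate[OF sim, where k = "1" and l = "1"])
    fix \<epsilon> \<sigma> :: real assume \<epsilon>: "0 < \<epsilon>" "\<epsilon> \<le> exp (- 1)" and \<sigma>: "0 < \<sigma>" "\<sigma> \<le> exp (- 1)"
    \<comment> \<open>With \<open>D\<close> the integer part of \<open>exp y\<close>, powers of
      \<open>D\<close> become exponentials in \<open>y\<close>, and \<open>d\<close> is the exponent
      from \<open>sqrt_sum_powr_le\<close>. The constant \<open>2 powr (2 * s)\<close> below pays
      for rounding down.\<close>
    define d where "d = 2 * t + 1 / 2"
    define L where "L = ln (1 / \<sigma>) powr (3 / 4)"
    define y where "y = min (2 * ln (1 / \<epsilon>) / (2 * s + d)) (ln (1 / \<sigma>) / t)"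
    have lns: "ln (1 / \<epsilon>) \<ge> 1" "ln (1 / \<sigma>) \<ge> 1" using ln_inverse_ge \<epsilon> \<sigma> by blast+
    have lt1: "\<epsilon> < 1" "\<sigma> < 1" using le_less_trans[OF \<epsilon>(2) small(2)] le_less_trans[OF \<sigma>(2) small(2)] by auto
    have d: "d > 0" using t by (simp add: d_def)
    have "L \<ge> 1" unfolding L_def using lns by (intro powr_ge_1) auto
    note bal = balanced_cutoff[OF s t d \<epsilon>(1) lt1(1) \<sigma>(1) lt1(2) this, folded y_def]
    have Q: "?Qi \<epsilon> \<sigma> = max (\<epsilon> powr (4 * s / (2 * s + d))) ((\<sigma> * L) powr (2 * min (s / t) 1))"
      by (simp add: d_def L_def add.assoc)
    have y0: "y \<ge> 0" using lns s t d by (auto simp: y_def)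
    then have "exp y \<ge> 1" by simp
    then obtain D where D: "D \<ge> 1" "real D \<le> exp y" "exp y / 2 \<le> real D"
      using obtain_floor by blast
    \<comment> \<open>The ratio to dominate is \<open>j powr (2 * t - 2 * s)\<close>. It is largest
      at the cutoff if \<open>t > s\<close> and at 1 otherwise, hence the maximum with 0.\<close>
    define B where "B = exp (max (2 * t - 2 * s) 0 * y)"
    have "1 / (real j powr (- t))\<^sup>2 \<le> B * (real j powr s)\<^sup>2" if j: "j \<in> {1..D}" for j
    proof -
      have "real j powr (2 * t - 2 * s) \<le> real j powr max (2 * t - 2 * s) 0"
        using j by (intro powr_mono) auto
      also have "\<dots> \<le> exp y powr max (2 * t - 2 * s) 0"
        using j D by (intro powr_mono2) auto
      also have "\<dots> = B" by (simp add: B_def powr_def)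
      finally have "real j powr (2 * t - 2 * s) * real j powr (2 * s) \<le> B * real j powr (2 * s)"
        by (intro mult_right_mono) auto
      then show ?thesis using j by (simp add: poly_sq powr_add[symmetric] del: max_def)
    qed
    moreover have "\<epsilon>\<^sup>2 * sqrt (\<Sum>j=1..D. (1 / (real j powr (- t))\<^sup>2)\<^sup>2) \<le> 2 powr (2 * s) * ?Qi \<epsilon> \<sigma>"
    proof (rule le_trans_mult)
      have "\<epsilon>\<^sup>2 * sqrt (\<Sum>j=1..D. (1 / (real j powr (- t))\<^sup>2)\<^sup>2) \<le> \<epsilon>\<^sup>2 * exp y powr (2 * t + 1 / 2)"
        using t D by (intro mult_left_mono sqrt_sum_powr_le) auto
      also have "\<dots> = \<epsilon>\<^sup>2 * exp (d * y)" by (simp add: d_def powr_def)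
      finally show "\<epsilon>\<^sup>2 * sqrt (\<Sum>j=1..D. (1 / (real j powr (- t))\<^sup>2)\<^sup>2) \<le> 1 * \<epsilon> powr (4 * s / (2 * s + d))"
        using bal(1) by simp
    qed (use s in \<open>auto simp: Q intro: powr_ge_1\<close>)
    moreover have "\<sigma>\<^sup>2 * B \<le> 2 powr (2 * s) * ?Qi \<epsilon> \<sigma>"
      by (rule le_trans_mult[where k = 1 and z = "(\<sigma> * L) powr (2 * min (s / t) 1)"])
        (use s bal(2) in \<open>auto simp: Q B_def intro: powr_ge_1\<close>)
    moreover have "1 / (real D powr s)\<^sup>2 \<le> 2 powr (2 * s) * ?Qi \<epsilon> \<sigma>"
    proof (rule le_trans_mult)
      have "1 / (real D powr s)\<^sup>2 = real D powr (- 2 * s)" using D(1) by (rule poly_sq(3))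
      also have "\<dots> \<le> (exp y / 2) powr (- 2 * s)" using D s by (intro powr_mono2') auto
      also have "\<dots> = 2 powr (2 * s) * exp (- 2 * s * y)"
        using div_powr[of "exp y" 2 "2 * s"] by (simp add: powr_def)
      finally show "1 / (real D powr s)\<^sup>2 \<le> 2 powr (2 * s) * exp (- 2 * s * y)" .
    qed (use bal(3) in \<open>simp_all add: Q\<close>)
    ultimately show "\<exists>D\<ge>1. \<exists>B\<ge>0. (\<forall>j\<in>{1..D}. 1 / (real j powr (- t))\<^sup>2 \<le> B * (real j powr s)\<^sup>2)
        \<and> \<epsilon>\<^sup>2 * sqrt (\<Sum>j=1..D. (1 / (real j powr (- t))\<^sup>2)\<^sup>2) \<le> 2 powr (2 * s) * ?Qi \<epsilon> \<sigma>
        \<and> \<sigma>\<^sup>2 * B \<le> 2 powr (2 * s) * ?Qi \<epsilon> \<sigma> \<and> 1 / (real D powr s)\<^sup>2 \<le> 2 powr (2 * s) * ?Qi \<epsilon> \<sigma>"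
      using D(1) by (intro exI[of _ D] conjI exI[of _ B]) (auto simp: B_def)
  qed auto

  let ?Qii = "\<lambda>\<epsilon> \<sigma>. max (\<epsilon>\<^sup>2 * ln (1 / \<epsilon>) powr (2 * t + 1 / 2)) (\<sigma>\<^sup>2 * ln (1 / \<sigma>) powr (3 / 2))"
  have ii: "lesssim_small (\<lambda>\<epsilon> \<sigma>. (minimax_radius a b \<alpha> \<beta> \<epsilon> \<sigma>)\<^sup>2) ?Qii"
    if sim: "seq_sim b (\<lambda>j. real j powr (- t))" "seq_sim a (\<lambda>j. exp (real j * s))"
  proof (rule rate[OF sim, where k = "s + 1" and l = "1"])
    \<comment> \<open>Exponential growth of \<open>a\<close> beats polynomial ill-posedness, so the
      \<open>\<sigma>\<close> term is bounded uniformly in the cutoff; \<open>powr_le_exp\<close>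
      with exponents \<open>2 * t\<close> and \<open>2 * s\<close> gives this value.\<close>
    define B where "B = (t / s) powr (2 * t)"
    define C where "C = s powr (- (2 * t + 1 / 2)) + B + exp (2 * s)"
    have B: "B \<ge> 0" by (simp add: B_def)
    show "C > 0" unfolding C_def using B by (intro add_nonneg_pos) auto
    have C: "s powr (- (2 * t + 1 / 2)) \<le> C" "B \<le> C" "exp (2 * s) \<le> C" using B by (auto simp: C_def)
    show "s + 1 > 0" "(1::real) > 0" using s by auto
    fix \<epsilon> \<sigma> :: real assume \<epsilon>: "0 < \<epsilon>" "\<epsilon> \<le> exp (- (s + 1))" and \<sigma>: "0 < \<sigma>" "\<sigma> \<le> exp (- 1)"
    \<comment> \<open>At this cutoff the squared bias is of order \<open>\<epsilon>\<^sup>2\<close>,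
      below the \<open>\<epsilon>\<close> rate. The range \<open>s + 1\<close> ensures both
      \<open>x \<ge> 1\<close> and a logarithm of at least 1.\<close>
    define x where "x = ln (1 / \<epsilon>) / s"
    have u: "ln (1 / \<epsilon>) \<ge> s + 1" and w: "ln (1 / \<sigma>) \<ge> 1" using ln_inverse_ge \<epsilon> \<sigma> by blast+
    have "x \<ge> 1" using u s by (simp add: x_def)
    then obtain D where D: "D \<ge> 1" "real D \<le> x" "x \<le> real D + 1" using obtain_floor by blast
    have "1 / (real j powr (- t))\<^sup>2 \<le> B * (exp (real j * s))\<^sup>2" if j: "j \<in> {1..D}" for j
      using powr_le_exp[of "real j" "2 * t" "2 * s"] j s t by (simp add: poly_sq exp_sq B_def)
    moreover have "\<epsilon>\<^sup>2 * sqrt (\<Sum>j=1..D. (1 / (real j powr (- t))\<^sup>2)\<^sup>2) \<le> C * ?Qii \<epsilon> \<sigma>"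
    proof (rule le_trans_mult)
      have "\<epsilon>\<^sup>2 * sqrt (\<Sum>j=1..D. (1 / (real j powr (- t))\<^sup>2)\<^sup>2) \<le> \<epsilon>\<^sup>2 * x powr (2 * t + 1 / 2)"
        using t D by (intro mult_left_mono sqrt_sum_powr_le) auto
      also have "x powr (2 * t + 1 / 2) = ln (1 / \<epsilon>) powr (2 * t + 1 / 2) * s powr (- (2 * t + 1 / 2))"
        unfolding x_def using div_powr[of "ln (1 / \<epsilon>)" s "- (2 * t + 1 / 2)"] u s
        by (simp only: minus_minus mult.commute)
      finally show "\<epsilon>\<^sup>2 * sqrt (\<Sum>j=1..D. (1 / (real j powr (- t))\<^sup>2)\<^sup>2)
          \<le> s powr (- (2 * t + 1 / 2)) * (\<epsilon>\<^sup>2 * ln (1 / \<epsilon>) powr (2 * t + 1 / 2))"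
        by (simp only: mult.commute mult.left_commute)
    qed (use C in auto)
    moreover have "\<sigma>\<^sup>2 * B \<le> C * ?Qii \<epsilon> \<sigma>"
    proof (rule le_trans_mult)
      show "\<sigma>\<^sup>2 * B \<le> B * \<sigma>\<^sup>2" by simp
      have "\<sigma>\<^sup>2 * 1 \<le> \<sigma>\<^sup>2 * ln (1 / \<sigma>) powr (3 / 2)"
        using w by (intro mult_left_mono powr_ge_1) auto
      then show "\<sigma>\<^sup>2 \<le> ?Qii \<epsilon> \<sigma>" by simp
    qed (use B C in auto)
    moreover have "1 / (exp (real D * s))\<^sup>2 \<le> C * ?Qii \<epsilon> \<sigma>"
    proof (rule le_trans_mult)
      have "2 * s * (x - 1) \<le> 2 * s * real D" using D s by (intro mult_left_mono) auto
      then have "- 2 * s * real D \<le> 2 * s + - 2 * ln (1 / \<epsilon>)"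
        using s by (simp add: x_def right_diff_distrib)
      then have "exp (- 2 * s * real D) \<le> exp (2 * s + - 2 * ln (1 / \<epsilon>))"
        by simp
      also have "\<dots> = exp (2 * s) * \<epsilon>\<^sup>2"
        using \<epsilon> by (simp add: exp_add ln_div exp_double)
      finally show "1 / (exp (real D * s))\<^sup>2 \<le> exp (2 * s) * \<epsilon>\<^sup>2" by (simp only: exp_sq(3))
      have "\<epsilon>\<^sup>2 * 1 \<le> \<epsilon>\<^sup>2 * ln (1 / \<epsilon>) powr (2 * t + 1 / 2)"
        using u s t by (intro mult_left_mono powr_ge_1) auto
      then show "\<epsilon>\<^sup>2 \<le> ?Qii \<epsilon> \<sigma>" by simp
    qed (use C in auto)
    ultimately show "\<exists>D\<ge>1. \<exists>B\<ge>0. (\<forall>j\<in>{1..D}. 1 / (real j powr (- t))\<^sup>2 \<le> B * (exp (real j * s))\<^sup>2)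
        \<and> \<epsilon>\<^sup>2 * sqrt (\<Sum>j=1..D. (1 / (real j powr (- t))\<^sup>2)\<^sup>2) \<le> C * ?Qii \<epsilon> \<sigma>
        \<and> \<sigma>\<^sup>2 * B \<le> C * ?Qii \<epsilon> \<sigma> \<and> 1 / (exp (real D * s))\<^sup>2 \<le> C * ?Qii \<epsilon> \<sigma>"
      using D(1) B by (intro exI[of _ D] conjI exI[of _ B]) auto
  qed auto

  let ?Qiii = "\<lambda>\<epsilon> \<sigma>. max (ln (1 / \<epsilon>) powr (- 2 * s))
      (ln (1 / (\<sigma> * ln (1 / \<sigma>) powr (1 / 2))) powr (- 2 * s))"
  have iii: "lesssim_small (\<lambda>\<epsilon> \<sigma>. (minimax_radius a b \<alpha> \<beta> \<epsilon> \<sigma>)\<^sup>2) ?Qiii"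
    if sim: "seq_sim b (\<lambda>j. exp (- real j * t))" "seq_sim a (\<lambda>j. real j powr s)"
  proof (rule rate[OF sim, where k = "2 * t + 1" and l = "2 * t + 1"])
    define M where "M = (2 * s) powr (2 * s)"
    define C where "C = ?c * M + M + (4 * t) powr (2 * s)"
    have M: "M > 0" using s by (simp add: M_def)
    show "C > 0" unfolding C_def using c M t by (intro add_pos_pos mult_pos_pos) auto
    have C: "?c * M \<le> C" "M \<le> C" "(4 * t) powr (2 * s) \<le> C"
      using c M mult_pos_pos[OF c M] by (auto simp: C_def)
    show "2 * t + 1 > 0" "2 * t + 1 > 0" using t by auto
    fix \<epsilon> \<sigma> :: real assume \<epsilon>: "0 < \<epsilon>" "\<epsilon> \<le> exp (- (2 * t + 1))" and \<sigma>: "0 < \<sigma>" "\<sigma> \<le> exp (- (2 * t + 1))"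
    define u where "u = ln (1 / \<epsilon>)"
    define w where "w = ln (1 / \<sigma>)"
    have uw: "u \<ge> 2 * t + 1" "w \<ge> 2 * t + 1" unfolding u_def w_def using ln_inverse_ge \<epsilon> \<sigma> by blast+
    have exps: "\<epsilon> = exp (- u)" "\<sigma> = exp (- w)" using \<epsilon> \<sigma> by (simp_all add: u_def w_def ln_div)
    have decay: "exp (- z) \<le> M * z powr (- 2 * s)" if "z > 0" for z
      using powr_le_exp[of z "2 * s" 1] that s by (simp add: M_def exp_minus powr_minus field_simps)
    \<comment> \<open>The logarithm in the rate equals \<open>w - ln w / 2\<close>, which lies
      strictly between 0 and \<open>w\<close> or equals \<open>w\<close>. A negative power reverses
      the comparison, so the correction only weakens the bound.\<close>
    have wQ: "w powr (- 2 * s) \<le> ?Qiii \<epsilon> \<sigma>"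
    proof -
      have "ln (1 / (\<sigma> * w powr (1 / 2))) = w - ln w / 2"
        using \<sigma> uw t by (simp add: ln_div ln_mult ln_powr exps(2))
      moreover have "ln w \<le> w - 1" "ln w \<ge> 0" using uw t by (auto intro: ln_le_minus_one)
      ultimately have "0 < ln (1 / (\<sigma> * w powr (1 / 2)))" "ln (1 / (\<sigma> * w powr (1 / 2))) \<le> w"
        using uw t by linarith+
      then have "w powr (- 2 * s) \<le> ln (1 / (\<sigma> * w powr (1 / 2))) powr (- 2 * s)"
        using s by (intro powr_mono2') auto
      then show ?thesis by (simp add: w_def le_max_iff_disj)
    qed
    have uQ: "u powr (- 2 * s) \<le> ?Qiii \<epsilon> \<sigma>" by (simp add: u_def)
    \<comment> \<open>This makes \<open>exp (2 * t * x)\<close> the smaller of the two inverse noise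
      levels. Both noise terms are then at most of order \<open>\<epsilon>\<close> and
      \<open>\<sigma>\<close>, negligible against powers of their logarithms, and the bias
      determines the rate.\<close>
    define x where "x = min u w / (2 * t)"
    have tx: "2 * t * x = min u w" using t by (simp add: x_def)
    have x1: "x \<ge> 1" using uw t by (simp add: x_def)
    then obtain D where D: "D \<ge> 1" "real D \<le> x" "x / 2 \<le> real D" using obtain_floor by blast
    \<comment> \<open>The gain from the polynomial \<open>a\<close> is discarded, using
      \<open>real j powr (2 * s) \<ge> 1\<close>.\<close>
    define B where "B = exp (2 * t * x)"
    have "1 / (exp (- real j * t))\<^sup>2 \<le> B * (real j powr s)\<^sup>2" if j: "j \<in> {1..D}" for j
    proof -
      have "exp (2 * t * real j) * 1 \<le> B * real j powr (2 * s)"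
        unfolding B_def using j D s t by (intro mult_mono powr_ge_1) auto
      then show ?thesis using j unfolding exp_sq(1) by (simp add: poly_sq)
    qed
    moreover have "\<epsilon>\<^sup>2 * sqrt (\<Sum>j=1..D. (1 / (exp (- real j * t))\<^sup>2)\<^sup>2) \<le> C * ?Qiii \<epsilon> \<sigma>"
    proof (rule le_trans_mult)
      have "\<epsilon>\<^sup>2 * sqrt (\<Sum>j=1..D. (1 / (exp (- real j * t))\<^sup>2)\<^sup>2) \<le> \<epsilon>\<^sup>2 * (?c * exp (2 * t * x))"
        using t D by (intro mult_left_mono sqrt_sum_exp_le) auto
      also have "\<dots> \<le> \<epsilon>\<^sup>2 * (?c * exp u)"
        using c unfolding tx by (intro mult_left_mono) auto
      also have "\<dots> = ?c * exp (- u)"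
        by (simp add: exps(1) exp_double[symmetric] exp_add[symmetric])
      also have "\<dots> \<le> ?c * (M * u powr (- 2 * s))"
        using c uw t by (intro mult_left_mono decay) auto
      finally show "\<epsilon>\<^sup>2 * sqrt (\<Sum>j=1..D. (1 / (exp (- real j * t))\<^sup>2)\<^sup>2) \<le> (?c * M) * u powr (- 2 * s)"
        by (simp only: mult.assoc)
    qed (use C c M uQ in auto)
    moreover have "\<sigma>\<^sup>2 * B \<le> C * ?Qiii \<epsilon> \<sigma>"
    proof (rule le_trans_mult)
      have "\<sigma>\<^sup>2 * B \<le> \<sigma>\<^sup>2 * exp w"
        unfolding B_def tx by (intro mult_left_mono) auto
      also have "\<dots> = exp (- w)"
        by (simp add: exps(2) exp_double[symmetric] exp_add[symmetric])
      finally show "\<sigma>\<^sup>2 * B \<le> M * w powr (- 2 * s)"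
        using decay[of w] uw t by linarith
    qed (use C M wQ in auto)
    moreover have "1 / (real D powr s)\<^sup>2 \<le> C * ?Qiii \<epsilon> \<sigma>"
    proof (rule le_trans_mult)
      have "1 / (real D powr s)\<^sup>2 = real D powr (- 2 * s)" using D(1) by (rule poly_sq(3))
      also have "\<dots> \<le> (x / 2) powr (- 2 * s)" using D s x1 by (intro powr_mono2') auto
      also have "x / 2 = min u w / (4 * t)" by (simp add: x_def)
      also have "\<dots> powr (- 2 * s) = (4 * t) powr (2 * s) * min u w powr (- 2 * s)"
        using div_powr[of "min u w" "4 * t" "2 * s"] t uw by simp
      finally show "1 / (real D powr s)\<^sup>2 \<le> (4 * t) powr (2 * s) * min u w powr (- 2 * s)" .
      show "min u w powr (- 2 * s) \<le> ?Qiii \<epsilon> \<sigma>"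
        using uQ wQ by (cases "u \<le> w") (auto simp: min_def)
    qed (use C in auto)
    ultimately show "\<exists>D\<ge>1. \<exists>B\<ge>0. (\<forall>j\<in>{1..D}. 1 / (exp (- real j * t))\<^sup>2 \<le> B * (real j powr s)\<^sup>2)
        \<and> \<epsilon>\<^sup>2 * sqrt (\<Sum>j=1..D. (1 / (exp (- real j * t))\<^sup>2)\<^sup>2) \<le> C * ?Qiii \<epsilon> \<sigma>
        \<and> \<sigma>\<^sup>2 * B \<le> C * ?Qiii \<epsilon> \<sigma> \<and> 1 / (real D powr s)\<^sup>2 \<le> C * ?Qiii \<epsilon> \<sigma>"
      using D(1) by (intro exI[of _ D] conjI exI[of _ B]) (auto simp: B_def)
  qed auto

  let ?Qiv = "\<lambda>\<epsilon> \<sigma>. max (\<epsilon> powr (2 * s / (s + t)))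
      ((\<sigma> * ln (1 / \<sigma>) powr (1 / 2)) powr (2 * min (s / t) 1))"
  have iv: "lesssim_small (\<lambda>\<epsilon> \<sigma>. (minimax_radius a b \<alpha> \<beta> \<epsilon> \<sigma>)\<^sup>2) ?Qiv"
    if sim: "seq_sim b (\<lambda>j. exp (- real j * t))" "seq_sim a (\<lambda>j. exp (real j * s))"
  proof (rule rate[OF sim, where k = "s + t" and l = "t + 1"])
    define C where "C = ?c + 1 + exp (2 * s)"
    show "C > 0" unfolding C_def using c by (intro add_pos_pos) auto
    have C: "?c \<le> C" "1 \<le> C" "exp (2 * s) \<le> C"
      using less_imp_le[OF c] by (auto simp: C_def intro: add_nonneg_nonneg)
    show "s + t > 0" "t + 1 > 0" using s t by auto
    fix \<epsilon> \<sigma> :: real assume \<epsilon>: "0 < \<epsilon>" "\<epsilon> \<le> exp (- (s + t))" and \<sigma>: "0 < \<sigma>" "\<sigma> \<le> exp (- (t + 1))"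
    \<comment> \<open>Since the geometric sum adds no factor of \<open>D\<close>, the growth
      exponent is \<open>2 * t\<close>. Here \<open>y\<close> itself is the cutoff before rounding;
      the ranges \<open>s + t\<close> and \<open>t + 1\<close> guarantee \<open>y \<ge> 1\<close>
      and \<open>L \<ge> 1\<close>.\<close>
    define d where "d = 2 * t"
    define L where "L = ln (1 / \<sigma>) powr (1 / 2)"
    define y where "y = min (2 * ln (1 / \<epsilon>) / (2 * s + d)) (ln (1 / \<sigma>) / t)"
    have lns: "ln (1 / \<epsilon>) \<ge> s + t" "ln (1 / \<sigma>) \<ge> t + 1" using ln_inverse_ge \<epsilon> \<sigma> by blast+
    have lt1: "\<epsilon> < 1" "\<sigma> < 1" using le_less_trans[OF \<epsilon>(2) small(2)] le_less_trans[OF \<sigma>(2) small(2)] s t by auto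
    have d: "d > 0" using t by (simp add: d_def)
    have "L \<ge> 1" unfolding L_def using lns t by (intro powr_ge_1) auto
    note bal = balanced_cutoff[OF s t d \<epsilon>(1) lt1(1) \<sigma>(1) lt1(2) this, folded y_def]
    have "4 * s / (2 * s + d) = 2 * s / (s + t)" using s t by (simp add: d_def field_simps)
    then have Q: "?Qiv \<epsilon> \<sigma> = max (\<epsilon> powr (4 * s / (2 * s + d))) ((\<sigma> * L) powr (2 * min (s / t) 1))"
      by (simp add: L_def)
    have "y \<ge> 1" using lns s t d by (auto simp: y_def d_def field_simps)
    then obtain D where D: "D \<ge> 1" "real D \<le> y" "y \<le> real D + 1"
      using obtain_floor by blast
    define B where "B = exp (max (2 * t - 2 * s) 0 * y)"
    have "1 / (exp (- real j * t))\<^sup>2 \<le> B * (exp (real j * s))\<^sup>2" if j: "j \<in> {1..D}" for j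
    proof -
      have "(2 * t - 2 * s) * real j \<le> max (2 * t - 2 * s) 0 * y"
        using j D by (intro mult_mono) auto
      then show ?thesis unfolding exp_sq B_def exp_add[symmetric] by (simp add: algebra_simps)
    qed
    moreover have "\<epsilon>\<^sup>2 * sqrt (\<Sum>j=1..D. (1 / (exp (- real j * t))\<^sup>2)\<^sup>2) \<le> C * ?Qiv \<epsilon> \<sigma>"
    proof (rule le_trans_mult)
      have "\<epsilon>\<^sup>2 * sqrt (\<Sum>j=1..D. (1 / (exp (- real j * t))\<^sup>2)\<^sup>2) \<le> \<epsilon>\<^sup>2 * (?c * exp (2 * t * y))"
        using t D by (intro mult_left_mono sqrt_sum_exp_le) auto
      also have "\<dots> = ?c * (\<epsilon>\<^sup>2 * exp (d * y))" by (simp add: d_def)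
      also have "\<dots> \<le> ?c * \<epsilon> powr (4 * s / (2 * s + d))"
        using c by (intro mult_left_mono bal(1)) auto
      finally show "\<epsilon>\<^sup>2 * sqrt (\<Sum>j=1..D. (1 / (exp (- real j * t))\<^sup>2)\<^sup>2) \<le> ?c * \<epsilon> powr (4 * s / (2 * s + d))" .
    qed (use C c in \<open>auto simp: Q\<close>)
    moreover have "\<sigma>\<^sup>2 * B \<le> C * ?Qiv \<epsilon> \<sigma>"
      by (rule le_trans_mult[where k = 1 and z = "(\<sigma> * L) powr (2 * min (s / t) 1)"])
        (use C bal(2) in \<open>auto simp: Q B_def\<close>)
    moreover have "1 / (exp (real D * s))\<^sup>2 \<le> C * ?Qiv \<epsilon> \<sigma>"
    proof (rule le_trans_mult)
      \<comment> \<open>Rounding \<open>y\<close> down loses at most 1, which costs the factor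
        \<open>exp (2 * s)\<close> in the bias.\<close>
      have "2 * s * (y - 1) \<le> 2 * s * real D" using D s by (intro mult_left_mono) auto
      then have "- 2 * s * real D \<le> 2 * s + - 2 * s * y"
        by (simp add: algebra_simps)
      then show "1 / (exp (real D * s))\<^sup>2 \<le> exp (2 * s) * exp (- 2 * s * y)"
        unfolding exp_sq(3) exp_add[symmetric] by simp
    qed (use C bal(3) in \<open>simp_all add: Q\<close>)
    ultimately show "\<exists>D\<ge>1. \<exists>B\<ge>0. (\<forall>j\<in>{1..D}. 1 / (exp (- real j * t))\<^sup>2 \<le> B * (exp (real j * s))\<^sup>2)
        \<and> \<epsilon>\<^sup>2 * sqrt (\<Sum>j=1..D. (1 / (exp (- real j * t))\<^sup>2)\<^sup>2) \<le> C * ?Qiv \<epsilon> \<sigma>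
        \<and> \<sigma>\<^sup>2 * B \<le> C * ?Qiv \<epsilon> \<sigma> \<and> 1 / (exp (real D * s))\<^sup>2 \<le> C * ?Qiv \<epsilon> \<sigma>"
      using D(1) by (intro exI[of _ D] conjI exI[of _ B]) (auto simp: B_def)
  qed auto

  from i ii iii iv show ?thesis by blast
qed

end
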